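(* Let $N\ge2$, let $\alpha_1,\dots,\alpha_{N-1}\in\{x,y,z\}$ satisfy $\alpha_i\ne\alpha_{i+1}$ for all $1\le i\le N-2$, and consider the Kitaev chain $$H(t)=\sum_{i=1}^{N-1}J_i^{\alpha_i}(t)\,\sigma_i^{\alpha_i}\sigma_{i+1}^{\alpha_i}$$ with real coefficients. Let $\Delta t>0$, let $n_t>N/2$ be an integer, $t_\tau=t_0+\tau\Delta t$, and let $$U(n_t\Delta t)=U_{n_t}\cdots U_2U_1,\qquad U_\tau=\prod_{i\ \mathrm{even}}R_i^{\alpha_i\alpha_i}(2J_i^{\alpha_i}(t_\tau)\Delta t)\ \prod_{i\ \mathrm{odd}}R_i^{\alpha_i\alpha_i}(2J_i^{\alpha_i}(t_\tau)\Delta t).$$ Then $U(n_t\Delta t)$ is equal to the operator of a square circuit on $N$ spins and also to the operator of a triangle circuit on $N$ spins, in both of which every gate at position $i$ is of the form $R_i^{\alpha_i\alpha_i}(\theta)$ for some real $\theta$. In particular $U(n_t\Delta t)$ is implemented by a circuit of depth $O(N)$, independent of $n_t$.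
   Context: $\sigma^x,\sigma^y,\sigma^z$ are the Pauli matrices, and $\sigma_i^\alpha=I^{\otimes(i-1)}\otimes\sigma^\alpha\otimes I^{\otimes(N-i)}$ on $(\mathbb C^2)^{\otimes N}$. $R_i^{\alpha\alpha}(\theta)=\exp(-\mathrm{i}\,\sigma_i^\alpha\sigma_{i+1}^\alpha\,\theta/2)$ for $1\le i\le N-1$; it is a gate at position $i$ (acting on spins $i,i+1$). Products over odd/even $i$ run over $i\in\{1,\dots,N-1\}$. A circuit is a time-ordered sequence of gates $g_1,\dots,g_m$ (first to last) with operator $g_m\cdots g_1$. An odd (even) layer consists of one gate at each odd (even) position in $\{1,\dots,N-1\}$. A square circuit on $N$ spins consists of $N$ layers, in time order alternately odd and even, the first being odd. A triangle circuit on $N$ spins consists, in time order, of $N-1$ descending cascades, the $k$-th containing $k$ gates at positions $N-k,N-k+1,\dots,N-1$ in this time order. *)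

theory Defs
  imports Complex_Main "HOL-Library.Landau_Symbols" "Jordan_Normal_Form.Matrix"
begin

text \<open>Operators on the space of N spins are complex matrices of dimension \<open>2 ^ N\<close>; the
  Jordan_Normal_Form matrices are used because N is quantified inside the theorem.\<close>

definition kron :: "complex mat \<Rightarrow> complex mat \<Rightarrow> complex mat" where
  "kron A B = mat (dim_row A * dim_row B) (dim_col A * dim_col B)
     (\<lambda>(i, j). A $$ (i div dim_row B, j div dim_col B) * B $$ (i mod dim_row B, j mod dim_col B))"

primrec kron_pow :: "complex mat \<Rightarrow> nat \<Rightarrow> complex mat" where
  "kron_pow A 0 = 1\<^sub>m 1"
| "kron_pow A (Suc n) = kron A (kron_pow A n)"

text \<open>The exponential series, summed entrywise.\<close>

definition mat_exp :: "complex mat \<Rightarrow> complex mat" where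
  "mat_exp A = mat (dim_row A) (dim_col A) (\<lambda>(i, j). \<Sum>k. (A ^\<^sub>m k) $$ (i, j) / fact k)"

text \<open>\<open>op_prod N [A\<^sub>1, \<dots>, A\<^sub>m]\<close> is \<open>A\<^sub>1 * \<dots> * A\<^sub>m\<close>, so the last operator of the list acts first.\<close>

definition op_prod :: "nat \<Rightarrow> complex mat list \<Rightarrow> complex mat" where
  "op_prod N As = foldr (*) As (1\<^sub>m (2 ^ N))"

definition op_sum :: "nat \<Rightarrow> complex mat list \<Rightarrow> complex mat" where
  "op_sum N As = foldr (+) As (0\<^sub>m (2 ^ N) (2 ^ N))"

datatype axis = AxisX | AxisY | AxisZ

primrec pauli :: "axis \<Rightarrow> complex mat" where
  "pauli AxisX = mat_of_rows_list 2 [[0, 1], [1, 0]]"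
| "pauli AxisY = mat_of_rows_list 2 [[0, - \<i>], [\<i>, 0]]"
| "pauli AxisZ = mat_of_rows_list 2 [[1, 0], [0, - 1]]"

text \<open>Spins are numbered from 1 to N.\<close>

definition spin :: "nat \<Rightarrow> axis \<Rightarrow> nat \<Rightarrow> complex mat" where
  "spin N a i = kron (kron (kron_pow (1\<^sub>m 2) (i - 1)) (pauli a)) (kron_pow (1\<^sub>m 2) (N - i))"

definition rot :: "nat \<Rightarrow> axis \<Rightarrow> nat \<Rightarrow> real \<Rightarrow> complex mat" where
  "rot N a i \<theta> = mat_exp ((- \<i> * complex_of_real \<theta> / 2) \<cdot>\<^sub>m (spin N a i * spin N a (i + 1)))"

definition kitaev_hamiltonian ::
  "nat \<Rightarrow> (nat \<Rightarrow> axis) \<Rightarrow> (nat \<Rightarrow> axis \<Rightarrow> real \<Rightarrow> real) \<Rightarrow> real \<Rightarrow> complex mat" where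
  "kitaev_hamiltonian N \<alpha> J t =
     op_sum N (map (\<lambda>i. complex_of_real (J i (\<alpha> i) t) \<cdot>\<^sub>m (spin N (\<alpha> i) i * spin N (\<alpha> i) (i + 1)))
       [1..<N])"

text \<open>The factors with even i commute with each other, as do those with odd i, so the order
  chosen inside the two products is immaterial.\<close>

definition trotter_step ::
  "nat \<Rightarrow> (nat \<Rightarrow> axis) \<Rightarrow> (nat \<Rightarrow> axis \<Rightarrow> real \<Rightarrow> real) \<Rightarrow> real \<Rightarrow> real \<Rightarrow> complex mat" where
  "trotter_step N \<alpha> J \<Delta>t t =
     op_prod N (map (\<lambda>i. rot N (\<alpha> i) i (2 * J i (\<alpha> i) t * \<Delta>t)) (filter even [1..<N])) *
     op_prod N (map (\<lambda>i. rot N (\<alpha> i) i (2 * J i (\<alpha> i) t * \<Delta>t)) (filter odd [1..<N]))"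

definition trotter_evolution ::
  "nat \<Rightarrow> (nat \<Rightarrow> axis) \<Rightarrow> (nat \<Rightarrow> axis \<Rightarrow> real \<Rightarrow> real) \<Rightarrow> real \<Rightarrow> real \<Rightarrow> nat \<Rightarrow> complex mat" where
  "trotter_evolution N \<alpha> J t\<^sub>0 \<Delta>t n\<^sub>t =
     op_prod N (map (\<lambda>\<tau>. trotter_step N \<alpha> J \<Delta>t (t\<^sub>0 + real \<tau> * \<Delta>t)) (rev [1..<n\<^sub>t + 1]))"

datatype gate = Gate (gate_pos: nat) (gate_axis: axis) (gate_angle: real)

definition gate_op :: "nat \<Rightarrow> gate \<Rightarrow> complex mat" where
  "gate_op N g = rot N (gate_axis g) (gate_pos g) (gate_angle g)"

definition gate_spins :: "gate \<Rightarrow> nat set" where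
  "gate_spins g = {gate_pos g, gate_pos g + 1}"

text \<open>A circuit is the list of its gates in time order.\<close>

type_synonym circuit = "gate list"

definition is_circuit :: "nat \<Rightarrow> circuit \<Rightarrow> bool" where
  "is_circuit N c \<longleftrightarrow> (\<forall>g \<in> set c. gate_pos g \<in> {1..N - 1})"

definition circuit_op :: "nat \<Rightarrow> circuit \<Rightarrow> complex mat" where
  "circuit_op N c = op_prod N (map (gate_op N) (rev c))"

definition odd_layer :: "nat \<Rightarrow> circuit \<Rightarrow> bool" where
  "odd_layer N l \<longleftrightarrow> distinct (map gate_pos l) \<and> gate_pos ` set l = {i \<in> {1..N - 1}. odd i}"

definition even_layer :: "nat \<Rightarrow> circuit \<Rightarrow> bool" where
  "even_layer N l \<longleftrightarrow> distinct (map gate_pos l) \<and> gate_pos ` set l = {i \<in> {1..N - 1}. even i}"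

definition square_circuit :: "nat \<Rightarrow> circuit \<Rightarrow> bool" where
  "square_circuit N c \<longleftrightarrow>
     (\<exists>ls. c = concat ls \<and> length ls = N \<and>
       (\<forall>k < N. if even k then odd_layer N (ls ! k) else even_layer N (ls ! k)))"

definition triangle_circuit :: "nat \<Rightarrow> circuit \<Rightarrow> bool" where
  "triangle_circuit N c \<longleftrightarrow> map gate_pos c = concat (map (\<lambda>k. [N - k..<N]) [1..<N])"

text \<open>The depth is the least number of time steps into which the gates can be scheduled such
  that gates sharing a spin are executed at different times, in their order in the circuit.\<close>

definition circuit_depth :: "circuit \<Rightarrow> nat" where
  "circuit_depth c =
     (LEAST d. \<exists>s :: nat \<Rightarrow> nat. (\<forall>k < length c. s k < d) \<and>
       (\<forall>k l. k < l \<and> l < length c \<and> gate_spins (c ! k) \<inter> gate_spins (c ! l) \<noteq> {} \<longrightarrow> s k < s l))"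

end

(* Write gates as words in their positions. Fusing two gates at one position, exchanging distant
   gates, and the Euler-angle turnover of three gates at adjacent positions show that the set of
   operators realised by circuits with a given word of positions depends only on the class of the
   word in the 0-Hecke monoid of the symmetric group. That monoid has a zero: the triangle word
   absorbs every letter on the right, its mirror image (the cotriangle) absorbs every letter on the
   left, so both are equal. Pulling the strand that starts at spin 1 out of the square's brick wall
   turns it into a cascade followed by a brick wall on one spin less, so by induction the square
   word represents the same zero. Padding with gates of angle 0, every circuit can be absorbed. *)

theory Submission
  imports Defs
begin

subsection \<open>Words in the 0-Hecke monoid\<close>

text \<open>A turnover changes its three angles jointly and nonlinearly, so angles are never tracked
  through a derivation: a word stands for the whole set \<open>realized\<close> of operators over
  all choices of angles, and each relation of words becomes an equality of sets. This demands that
  every relation be reversible on operators. Fusing is undone by splitting off a gate of angle 0,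
  and the turnover is available in both directions. It exists because the bonds at positions i and
  i+1 share one spin and carry different axes there, hence anticommute: their gates are unit
  quaternions, and these can be written as P-Q-P as well as Q-P-Q rotations.

  The N layers of the square hold N(N-1)/2 letters, the length of the longest permutation of N
  strands. Passing from the square to the cotriangle therefore needs only braids and commutations;
  fusing enters only through absorption. Absorption also explains the independence of the number of
  Trotter steps: a word of any length disappears into the triangle.\<close>

inductive hecke :: "nat list \<Rightarrow> nat list \<Rightarrow> bool" (infix "\<approx>" 50) where
  hecke_refl [simp, intro]: "w \<approx> w"
| hecke_sym: "v \<approx> w \<Longrightarrow> w \<approx> v"
| hecke_trans [trans]: "u \<approx> v \<Longrightarrow> v \<approx> w \<Longrightarrow> u \<approx> w"
| hecke_append: "u \<approx> u' \<Longrightarrow> v \<approx> v' \<Longrightarrow> u @ v \<approx> u' @ v'"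
| hecke_idem: "[i, i] \<approx> [i]"
| hecke_comm: "Suc i < j \<Longrightarrow> [i, j] \<approx> [j, i]"
| hecke_braid: "[i, Suc i, i] \<approx> [Suc i, i, Suc i]"

lemma hecke_append_left: "v \<approx> v' \<Longrightarrow> u @ v \<approx> u @ v'"
  by (simp add: hecke_append)

lemma hecke_append_right: "u \<approx> u' \<Longrightarrow> u @ v \<approx> u' @ v"
  by (simp add: hecke_append)

text \<open>Word length is not invariant but the letters are, since each relation has the same
  letters on both sides. Hence a derivation that starts in \<open>{1..<N}\<close> never leaves it,
  although \<open>hecke\<close> itself knows no \<open>N\<close>.\<close>

lemma hecke_set: "u \<approx> v \<Longrightarrow> set u = set v"
  by (induction rule: hecke.induct) auto

abbreviation far :: "nat \<Rightarrow> nat \<Rightarrow> bool" where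
  "far i j \<equiv> Suc i < j \<or> Suc j < i"

lemma hecke_commute_letter:
  assumes "\<forall>j\<in>set v. far i j"
  shows "[i] @ v \<approx> v @ [i]"
  using assms
proof (induction v)
  case (Cons j v)
  then have "[i, j] \<approx> [j, i]"
    by (metis hecke_comm hecke_sym list.set_intros(1))
  then have "[i, j] @ v \<approx> [j, i] @ v"
    by (rule hecke_append_right)
  also have "[j, i] @ v = [j] @ ([i] @ v)" by simp
  also have "[j] @ ([i] @ v) \<approx> [j] @ (v @ [i])"
    using Cons by (intro hecke_append_left) auto
  finally show ?case by simp
qed simp

lemma hecke_commute:
  assumes "\<forall>i\<in>set u. \<forall>j\<in>set v. far i j"
  shows "u @ v \<approx> v @ u"
  using assms
proof (induction u)
  case (Cons i u)
  have "[i] @ (u @ v) \<approx> [i] @ (v @ u)"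
    using Cons by (intro hecke_append_left) auto
  also have "[i] @ (v @ u) = ([i] @ v) @ u" by simp
  also have "([i] @ v) @ u \<approx> (v @ [i]) @ u"
    using Cons.prems by (intro hecke_append_right hecke_commute_letter) auto
  finally show ?case by simp
qed simp

text \<open>The letter \<open>i\<close> commutes leftwards past everything above
  \<open>Suc i\<close>, meets \<open>i, Suc i\<close> and is braided into \<open>Suc i\<close>,
  which then commutes past everything below \<open>i\<close>. A cascade thus acts as a shift by one
  on letters that cross it.\<close>

lemma cascade_letter:
  assumes "a \<le> i" "Suc i < b"
  shows "[a..<b] @ [i] \<approx> [Suc i] @ [a..<b]"
proof -
  let ?A = "[a..<i]" and ?B = "[Suc (Suc i)..<b]"
  have split: "[a..<b] = ?A @ [i, Suc i] @ ?B"
  proof -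
    have "[a..<b] = [a..<i] @ [i..<b]"
      using assms upt_add_eq_append[of a i "b - i"] by simp
    also have "[i..<b] = [i, Suc i] @ ?B"
      using assms by (simp add: upt_conv_Cons)
    finally show ?thesis .
  qed
  have "[a..<b] @ [i] = (?A @ [i, Suc i]) @ (?B @ [i])"
    by (simp add: split)
  also have "\<dots> \<approx> (?A @ [i, Suc i]) @ ([i] @ ?B)"
    by (intro hecke_append_left hecke_commute) auto
  also have "\<dots> = ?A @ [i, Suc i, i] @ ?B" by simp
  also have "\<dots> \<approx> ?A @ [Suc i, i, Suc i] @ ?B"
    by (intro hecke_append_left hecke_append_right hecke_braid)
  also have "\<dots> = (?A @ [Suc i]) @ ([i, Suc i] @ ?B)" by simp
  also have "\<dots> \<approx> ([Suc i] @ ?A) @ ([i, Suc i] @ ?B)"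
    by (intro hecke_append_right hecke_commute) auto
  also have "\<dots> = [Suc i] @ [a..<b]" by (simp add: split)
  finally show ?thesis .
qed

lemma cascade_word:
  assumes "\<forall>i\<in>set w. a \<le> i \<and> Suc i < b"
  shows "[a..<b] @ w \<approx> map Suc w @ [a..<b]"
  using assms
proof (induction w)
  case (Cons i w)
  have "[a..<b] @ (i # w) = ([a..<b] @ [i]) @ w" by simp
  also have "\<dots> \<approx> ([Suc i] @ [a..<b]) @ w"
    using Cons.prems by (intro hecke_append_right cascade_letter) auto
  also have "\<dots> = [Suc i] @ ([a..<b] @ w)" by simp
  also have "\<dots> \<approx> [Suc i] @ (map Suc w @ [a..<b])"
    using Cons by (intro hecke_append_left) auto
  finally show ?case by simp
qed simp

lemma absorb_left_word:
  assumes "\<And>i. i \<in> set w \<Longrightarrow> [i] @ t \<approx> t"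
  shows "w @ t \<approx> t"
  using assms
proof (induction w)
  case (Cons i w)
  have "[i] @ (w @ t) \<approx> [i] @ t"
    using Cons by (intro hecke_append_left) auto
  also have "[i] @ t \<approx> t" using Cons.prems by simp
  finally show ?case by simp
qed simp

lemma absorb_right_word:
  assumes "\<And>i. i \<in> set w \<Longrightarrow> t @ [i] \<approx> t"
  shows "t @ w \<approx> t"
  using assms
proof (induction w)
  case (Cons i w)
  have "t @ (i # w) = (t @ [i]) @ w" by simp
  also have "\<dots> \<approx> t @ w"
    using Cons.prems by (intro hecke_append_right) auto
  also have "\<dots> \<approx> t" using Cons by auto
  finally show ?case .
qed simp

section \<open>Triangle and cotriangle words as absorbing elements\<close>

definition triangle_word :: "nat \<Rightarrow> nat \<Rightarrow> nat list" where
  "triangle_word N n = concat (map (\<lambda>k. [N - k..<N]) [1..<Suc n])"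

lemma triangle_word_Suc: "triangle_word N (Suc n) = triangle_word N n @ [N - Suc n..<N]"
  by (simp add: triangle_word_def)

text \<open>Below the top position, the letter crosses the last cascade as \<open>Suc i\<close> and
  falls into the range of the smaller triangle; at the top position \<open>N - 1\<close> it repeats
  the final letter and is fused. The number \<open>n\<close> of cascades is separate from
  \<open>N\<close> so that the induction can keep the upper end fixed.\<close>

lemma triangle_word_absorb:
  assumes "n < N" "N - n \<le> i" "i < N"
  shows "triangle_word N n @ [i] \<approx> triangle_word N n"
  using assms
proof (induction n arbitrary: i)
  case (Suc n)
  let ?C = "[N - Suc n..<N]"
  show ?case
  proof (cases "Suc i < N")
    case True
    have "triangle_word N (Suc n) @ [i] = triangle_word N n @ (?C @ [i])"
      by (simp add: triangle_word_Suc)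
    also have "\<dots> \<approx> triangle_word N n @ ([Suc i] @ ?C)"
      using True Suc.prems by (intro hecke_append_left cascade_letter) auto
    also have "\<dots> = (triangle_word N n @ [Suc i]) @ ?C" by simp
    also have "\<dots> \<approx> triangle_word N n @ ?C"
      using True Suc.prems by (intro hecke_append_right Suc.IH) auto
    finally show ?thesis by (simp add: triangle_word_Suc)
  next
    case False
    then have i: "i = N - 1" using Suc.prems by simp
    have C: "?C = [N - Suc n..<N - 1] @ [i]"
      using Suc.prems i upt_Suc_append[of "N - Suc n" "N - 1"] by simp
    have "triangle_word N (Suc n) @ [i] = (triangle_word N n @ [N - Suc n..<N - 1]) @ [i, i]"
      by (simp add: triangle_word_Suc C)
    also have "\<dots> \<approx> (triangle_word N n @ [N - Suc n..<N - 1]) @ [i]"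
      by (intro hecke_append_left hecke_idem)
    also have "\<dots> = triangle_word N (Suc n)" by (simp add: triangle_word_Suc C)
    finally show ?thesis .
  qed
qed simp

text \<open>Another reduced word of the longest permutation of the strands \<open>1\<close> to
  \<open>N\<close>. Its cascades all start at \<open>1\<close> and shrink, so its recursion matches
  the removal of the strand of spin 1 from the brick wall.\<close>

primrec cotriangle_word :: "nat \<Rightarrow> nat list" where
  "cotriangle_word 0 = []"
| "cotriangle_word (Suc n) = [1..<Suc n] @ cotriangle_word n"

text \<open>Mirror image of the triangle argument: a letter \<open>i > 1\<close> crosses the first
  cascade from the left and emerges as \<open>i - 1\<close>, while \<open>1\<close> fuses with the
  letter that opens the cascade.\<close>

lemma cotriangle_word_absorb:
  assumes "1 \<le> i" "i < N"
  shows "[i] @ cotriangle_word N \<approx> cotriangle_word N"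
  using assms
proof (induction N arbitrary: i)
  case (Suc n)
  show ?case
  proof (cases "i = 1")
    case True
    then have C: "[1..<Suc n] = [1] @ [2..<Suc n]"
      using Suc.prems by (simp add: upt_conv_Cons numeral_2_eq_2)
    have "[i] @ cotriangle_word (Suc n) = [1, 1] @ ([2..<Suc n] @ cotriangle_word n)"
      by (simp only: cotriangle_word.simps C True append_assoc) simp
    also have "\<dots> \<approx> [1] @ ([2..<Suc n] @ cotriangle_word n)"
      by (intro hecke_append_right hecke_idem)
    also have "\<dots> = cotriangle_word (Suc n)"
      by (simp only: cotriangle_word.simps C append_assoc)
    finally show ?thesis .
  next
    case False
    then obtain j where j: "i = Suc j" "1 \<le> j"
      using Suc.prems by (cases i) auto
    have "[i] @ cotriangle_word (Suc n) = ([Suc j] @ [1..<Suc n]) @ cotriangle_word n"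
      using j by simp
    also have "\<dots> \<approx> ([1..<Suc n] @ [j]) @ cotriangle_word n"
      using j Suc.prems by (intro hecke_append_right hecke_sym[OF cascade_letter]) auto
    also have "\<dots> = [1..<Suc n] @ ([j] @ cotriangle_word n)" by simp
    also have "\<dots> \<approx> [1..<Suc n] @ cotriangle_word n"
      using j Suc.prems by (intro hecke_append_left Suc.IH) auto
    finally show ?thesis by simp
  qed
qed simp

section \<open>The brick wall and its reduction to the cotriangle\<close>

definition parity_row :: "nat \<Rightarrow> nat \<Rightarrow> nat \<Rightarrow> nat list" where
  "parity_row m a b = filter (\<lambda>q. even (q + m)) [a..<b]"

lemma set_parity_row: "set (parity_row m a b) = {q. a \<le> q \<and> q < b \<and> even (q + m)}"
  by (auto simp: parity_row_def)

lemma parity_row_empty [simp]: "b \<le> a \<Longrightarrow> parity_row m a b = []"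
  by (simp add: parity_row_def)

lemma parity_row_split: "a \<le> c \<Longrightarrow> c \<le> b \<Longrightarrow> parity_row m a b = parity_row m a c @ parity_row m c b"
  using upt_add_eq_append[of a c "b - c"] by (simp add: parity_row_def)

lemma parity_row_add2 [simp]: "parity_row (Suc (Suc m)) a b = parity_row m a b"
  by (simp add: parity_row_def)

lemma parity_row_diag: "m < b \<Longrightarrow> parity_row m m b = m # parity_row m (Suc m) b"
  by (simp add: parity_row_def upt_conv_Cons)

lemma parity_row_diag_skip: "parity_row (Suc m) m b = parity_row (Suc m) (Suc m) b"
  by (cases "m < b") (simp_all add: parity_row_def upt_conv_Cons)

lemma map_Suc_parity_row: "map Suc (parity_row (Suc m) a b) = parity_row m (Suc a) (Suc b)"
  unfolding parity_row_def map_Suc_upt[symmetric] filter_map by (auto intro!: arg_cong[where f = "map Suc"] filter_cong)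

text \<open>The layer index carries the parity, so \<open>s\<close> selects the parity of the first
  layer; \<open>brick 1 N\<close> is the square. Removing a strand flips this parity, which is why
  \<open>s\<close> must vary.\<close>

definition brick :: "nat \<Rightarrow> nat \<Rightarrow> nat list" where
  "brick s N = concat (map (\<lambda>m. parity_row m 1 N) [s..<s + N])"

lemma brick_add2: "brick (Suc (Suc s)) N = brick s N"
proof -
  have "[Suc (Suc s)..<Suc (Suc s) + N] = map (\<lambda>m. Suc (Suc m)) [s..<s + N]"
    by (simp add: map_Suc_upt[symmetric] o_def del: upt_Suc)
  then show ?thesis by (simp add: brick_def o_def del: upt_Suc)
qed

text \<open>Equal parity improves \<open>q < m\<close> to a distance of at least two, which is what
  \<open>far\<close> requires.\<close>

lemma parity_gap:
  fixes q m n :: nat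
  shows "q < m \<Longrightarrow> m \<le> n \<Longrightarrow> even (q + m) \<Longrightarrow> Suc q < n"
  by presburger

text \<open>Layer \<open>m\<close> holds the positions of the parity of \<open>m\<close>; the diagonal of the position \<open>m\<close> in
  layer \<open>m\<close> is the path of the strand that starts at spin 1.\<close>

lemma brick_pull_diagonal:
  assumes "s \<le> 1" "s \<le> n" "n \<le> N"
  shows "concat (map (\<lambda>m. parity_row m 1 N) [s..<n]) \<approx>
    concat (map (\<lambda>m. parity_row m (Suc m) N) [s..<n]) @ [1..<n] @ concat (map (\<lambda>m. parity_row m 1 m) [s..<n])"
  using assms(2,3)
proof (induction n rule: dec_induct)
  case base
  then show ?case using assms by simp
next
  case (step n)
  let ?B = "\<lambda>n. concat (map (\<lambda>m. parity_row m 1 N) [s..<n])"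
  let ?R = "\<lambda>n. concat (map (\<lambda>m. parity_row m (Suc m) N) [s..<n])"
  let ?L = "\<lambda>n. concat (map (\<lambda>m. parity_row m 1 m) [s..<n])"
  have S: "?B (Suc n) = ?B n @ parity_row n 1 N" "?R (Suc n) = ?R n @ parity_row n (Suc n) N"
    "?L (Suc n) = ?L n @ parity_row n 1 n" using step.hyps by simp_all
  show ?case
  proof (cases "n = 0")
    \<comment> \<open>Layer 0 occurs only for \<open>s = 0\<close>. Its diagonal position 0 is not a
      letter, so the whole layer lies right of the diagonal.\<close>
    case True
    then show ?thesis using step by (simp add: S)
  next
    case False
    have D: "[1..<Suc n] = [1..<n] @ [n]" using False by simp
    have parity_row: "parity_row n 1 N = parity_row n 1 n @ [n] @ parity_row n (Suc n) N"
      using False step.prems parity_row_split[of 1 n N n] parity_row_diag[of n N] by simp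
    \<comment> \<open>All letters left of the diagonal, in the old layers and in layer
      \<open>n\<close>, are far from \<open>n\<close> and from everything above it. They can be
      moved behind the rest of layer \<open>n\<close>.\<close>
    have L: "\<forall>q\<in>set (?L n @ parity_row n 1 n). Suc q < n"
    by (auto simp: set_parity_row simp del: even_add intro: parity_gap[OF _ less_imp_le] parity_gap[OF _ order.refl])
    have "?B (Suc n) \<approx> (?R n @ [1..<n] @ ?L n) @ (parity_row n 1 n @ [n] @ parity_row n (Suc n) N)"
      unfolding S parity_row using step by (intro hecke_append_right) auto
    also have "\<dots> = (?R n @ [1..<n]) @ ((?L n @ parity_row n 1 n) @ ([n] @ parity_row n (Suc n) N))"
      by simp
    also have "\<dots> \<approx> (?R n @ [1..<n]) @ (([n] @ parity_row n (Suc n) N) @ (?L n @ parity_row n 1 n))"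
      using L by (intro hecke_append_left hecke_commute) (fastforce simp: set_parity_row)
    also have "\<dots> = ?R n @ ([1..<Suc n] @ parity_row n (Suc n) N) @ ?L n @ parity_row n 1 n"
      unfolding D by simp
    also have "\<dots> \<approx> ?R n @ (parity_row n (Suc n) N @ [1..<Suc n]) @ ?L n @ parity_row n 1 n"
    proof (intro hecke_append_left hecke_append_right hecke_commute ballI)
      \<comment> \<open>The neighbour \<open>j = Suc n\<close> of the cascade's last letter has the
        wrong parity for layer \<open>n\<close>, so the right part of the layer starts no lower than
        \<open>n + 2\<close>.\<close>
      fix i j assume "i \<in> set [1..<Suc n]" "j \<in> set (parity_row n (Suc n) N)"
      then have "i \<le> n" "Suc n \<le> j" "even (j + n)" by (auto simp: set_parity_row)
      then show "far i j" by (cases "j = Suc n") auto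
    qed
    finally show ?thesis by (simp only: S append_assoc)
  qed
qed

text \<open>Cuts the wall of the smaller chain along the diagonal, now with the diagonal letters
  kept in the right part, so that it can be compared with what remains after a strand has been
  pulled out. The bound \<open>min m M\<close> covers layers whose diagonal position lies beyond the
  last letter.\<close>

lemma brick_split_diagonal:
  assumes "t \<ge> 1" "t \<le> n"
  shows "concat (map (\<lambda>m. parity_row m 1 M) [t..<n]) \<approx>
    concat (map (\<lambda>m. parity_row m m M) [t..<n]) @ concat (map (\<lambda>m. parity_row m 1 (min m M)) [t..<n])"
  using assms(2)
proof (induction n rule: dec_induct)
  case (step n)
  let ?B = "\<lambda>n. concat (map (\<lambda>m. parity_row m 1 M) [t..<n])"
  let ?R = "\<lambda>n. concat (map (\<lambda>m. parity_row m m M) [t..<n])"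
  let ?L = "\<lambda>n. concat (map (\<lambda>m. parity_row m 1 (min m M)) [t..<n])"
  have S: "?B (Suc n) = ?B n @ parity_row n 1 M" "?R (Suc n) = ?R n @ parity_row n n M"
    "?L (Suc n) = ?L n @ parity_row n 1 (min n M)" using step.hyps by simp_all
  have parity_row: "parity_row n 1 M = parity_row n 1 (min n M) @ parity_row n n M"
    using parity_row_split[of 1 n M n] step.hyps assms by (cases "n \<le> M") (auto simp: min_def)
  have L: "\<forall>q\<in>set (?L n @ parity_row n 1 (min n M)). Suc q < n"
  by (auto simp: set_parity_row simp del: even_add intro: parity_gap[OF _ less_imp_le] parity_gap[OF _ order.refl])
  have "?B (Suc n) \<approx> (?R n @ ?L n) @ (parity_row n 1 (min n M) @ parity_row n n M)"
    unfolding S parity_row using step by (intro hecke_append_right) auto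
  also have "\<dots> = ?R n @ ((?L n @ parity_row n 1 (min n M)) @ parity_row n n M)" by simp
  also have "\<dots> \<approx> ?R n @ (parity_row n n M @ (?L n @ parity_row n 1 (min n M)))"
    using L by (intro hecke_append_left hecke_commute) (fastforce simp: set_parity_row)
  finally show ?case by (simp only: S append_assoc)
qed simp

lemma concat_map_upt_Suc:
  "concat (map (\<lambda>m. f (Suc m)) [a..<b]) = concat (map f [Suc a..<Suc b])"
  by (simp only: map_Suc_upt[symmetric] map_map o_def)

text \<open>Once the diagonal is pulled out, a letter \<open>q\<close> of layer \<open>m\<close> to
  its right moves to position \<open>q - 1\<close> of layer \<open>m + 1\<close> by crossing the
  cascade, and a letter to its left stays put. Both moves keep position and layer of equal parity,
  and the two halves fit together to the wall on one spin less that starts with layer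
  \<open>Suc s\<close>.\<close>

lemma brick_cascade:
  assumes s: "s \<le> 1"
  shows "brick s (Suc N) \<approx> [1..<Suc N] @ brick (Suc s) N"
proof -
  let ?n = "Suc N"
  let ?R = "concat (map (\<lambda>m. parity_row m (Suc m) ?n) [s..<?n])"
  let ?R' = "concat (map (\<lambda>m. parity_row m m N) [Suc s..<Suc s + N])"
  let ?L = "concat (map (\<lambda>m. parity_row m 1 m) [s..<?n])"
  let ?L' = "concat (map (\<lambda>m. parity_row m 1 (min m N)) [Suc s..<Suc s + N])"
  let ?E = "concat (map (\<lambda>m. parity_row m 1 ?n) [?n..<s + ?n])"
  \<comment> \<open>The diagonal reaches its last letter \<open>N\<close> in layer \<open>N\<close>.
    For \<open>s = 1\<close> the wall has one further layer, which is \<open>?E\<close>; for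
    \<open>s = 0\<close> this remainder is empty.\<close>
  have B: "brick s ?n = concat (map (\<lambda>m. parity_row m 1 ?n) [s..<?n]) @ ?E"
    using s upt_add_eq_append[of s ?n s] by (simp add: brick_def add.commute del: upt_Suc)
  have R: "?R = map Suc ?R'"
  proof -
    have "?R = map Suc (concat (map (\<lambda>m. parity_row (Suc m) m N) [s..<?n]))"
      by (simp add: map_concat o_def map_Suc_parity_row del: upt_Suc)
    also have "concat (map (\<lambda>m. parity_row (Suc m) m N) [s..<?n]) =
        concat (map (\<lambda>m. parity_row m m N) [Suc s..<Suc ?n])"
      unfolding parity_row_diag_skip by (rule concat_map_upt_Suc)
    also have "\<dots> = ?R'"
      using s by (cases "s = 0") (simp_all add: le_Suc_eq)
    finally show ?thesis .
  qed
  have L: "?L @ ?E = ?L'"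
  proof (cases "s = 0")
    case True
    have "map (\<lambda>m. parity_row m 1 m) [Suc 0..<?n] = map (\<lambda>m. parity_row m 1 (min m N)) [Suc 0..<?n]"
      by (rule map_cong) auto
    with True show ?thesis by (simp add: upt_conv_Cons[of 0] del: upt_Suc map_eq_conv)
  next
    case False
    with s have s: "s = Suc 0" by simp
    show ?thesis
    proof (cases "N = 0")
      case False
      let ?M = "concat (map (\<lambda>m. parity_row m 1 m) [2..<?n])"
      have "[s..<?n] = 1 # [2..<?n]"
        using False by (simp add: s upt_conv_Cons numeral_2_eq_2 del: upt_Suc)
      then have L: "?L = ?M" by (simp del: upt_Suc)
      have E: "?E = parity_row ?n 1 ?n" by (simp add: s)
      have L': "?L' = concat (map (\<lambda>m. parity_row m 1 (min m N)) [2..<?n]) @ parity_row ?n 1 N"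
        using False by (simp add: s numeral_2_eq_2)
      \<comment> \<open>The two ranges differ in position \<open>N\<close> only, which has the wrong
        parity for layer \<open>Suc N\<close>.\<close>
      have "parity_row ?n 1 ?n = parity_row ?n 1 N"
        by (auto simp: parity_row_def)
      moreover have "map (\<lambda>m. parity_row m 1 m) [2..<?n] = map (\<lambda>m. parity_row m 1 (min m N)) [2..<?n]"
        by (rule map_cong) auto
      ultimately show ?thesis unfolding L E L' by (simp only:)
    qed (simp add: s)
  qed
  have "brick s ?n \<approx> (?R @ [1..<?n] @ ?L) @ ?E"
    unfolding B using s by (intro hecke_append_right brick_pull_diagonal) auto
  also have "\<dots> = (map Suc ?R' @ [1..<?n]) @ ?L'"
    using L by (simp add: R del: upt_Suc)
  also have "\<dots> \<approx> ([1..<?n] @ ?R') @ ?L'"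
    by (intro hecke_append_right hecke_sym[OF cascade_word]) (auto simp: set_parity_row)
  also have "\<dots> = [1..<?n] @ (?R' @ ?L')" by simp
  also have "\<dots> \<approx> [1..<?n] @ brick (Suc s) N"
    unfolding brick_def by (intro hecke_append_left hecke_sym[OF brick_split_diagonal]) auto
  finally show ?thesis .
qed

lemma brick_eq_cotriangle:
  assumes "s \<le> 1"
  shows "brick s N \<approx> cotriangle_word N"
  using assms
proof (induction N arbitrary: s)
  case 0
  then show ?case by (simp add: brick_def)
next
  case (Suc N)
  have IH: "brick (Suc s) N \<approx> cotriangle_word N"
  proof (cases "s = 0")
    case False
    then have "brick (Suc s) N = brick 0 N"
      using Suc.prems brick_add2[of 0 N] by (simp add: le_Suc_eq)
    then show ?thesis using Suc.IH[of 0] by simp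
  qed (simp add: Suc.IH)
  have "brick s (Suc N) \<approx> [1..<Suc N] @ brick (Suc s) N"
    using Suc.prems by (rule brick_cascade)
  also have "\<dots> \<approx> [1..<Suc N] @ cotriangle_word N"
    using IH by (rule hecke_append_left)
  finally show ?case by simp
qed

subsection \<open>Spin operators and rotations\<close>

lemma sum_div_mod:
  fixes f :: "nat \<Rightarrow> nat \<Rightarrow> 'a::comm_monoid_add"
  shows "(\<Sum>k<n * m. f (k div m) (k mod m)) = (\<Sum>a<n. \<Sum>b<m. f a b)"
proof -
  have lt: "a * m + b < n * m" if "a < n" "b < m" for a b
  proof -
    have "a * m + b < Suc a * m" using that by simp
    also have "\<dots> \<le> n * m" using that by (intro mult_le_mono1) simp
    finally show ?thesis .
  qed
  have "(\<Sum>k<n * m. f (k div m) (k mod m)) = (\<Sum>(a, b)\<in>{..<n} \<times> {..<m}. f a b)"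
    by (rule sum.reindex_bij_witness[of _ "\<lambda>(a, b). a * m + b" "\<lambda>k. (k div m, k mod m)"])
      (auto simp: less_mult_imp_div_less lt intro!: mod_less_divisor gr0I)
  then show ?thesis by (simp add: sum.cartesian_product)
qed

lemma kron_carrier [simp]:
  "A \<in> carrier_mat n n' \<Longrightarrow> B \<in> carrier_mat m m' \<Longrightarrow> kron A B \<in> carrier_mat (n * m) (n' * m')"
  by (auto simp: kron_def)

lemma kron_mult:
  assumes "A \<in> carrier_mat n n" "B \<in> carrier_mat m m" "C \<in> carrier_mat n n" "D \<in> carrier_mat m m"
  shows "kron A B * kron C D = kron (A * C) (B * D)"
proof (rule eq_matI)
  fix i j assume "i < dim_row (kron (A * C) (B * D))" "j < dim_col (kron (A * C) (B * D))"
  then have ij: "i < n * m" "j < n * m" using assms by (auto simp: kron_def)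
  then have lt: "i div m < n" "j div m < n" "i mod m < m" "j mod m < m"
    by (auto simp: less_mult_imp_div_less intro!: mod_less_divisor gr0I)
  have "(kron A B * kron C D) $$ (i, j) = (\<Sum>k<n * m.
      (A $$ (i div m, k div m) * B $$ (i mod m, k mod m)) *
      (C $$ (k div m, j div m) * D $$ (k mod m, j mod m)))"
    using assms ij by (simp add: kron_def scalar_prod_def lessThan_atLeast0)
  also have "\<dots> = (\<Sum>a<n. \<Sum>b<m. (A $$ (i div m, a) * B $$ (i mod m, b)) *
      (C $$ (a, j div m) * D $$ (b, j mod m)))"
    by (rule sum_div_mod)
  also have "\<dots> = (\<Sum>a<n. A $$ (i div m, a) * C $$ (a, j div m)) *
      (\<Sum>b<m. B $$ (i mod m, b) * D $$ (b, j mod m))"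
    by (simp add: sum_product ac_simps)
  also have "\<dots> = kron (A * C) (B * D) $$ (i, j)"
    using assms ij lt by (simp add: kron_def scalar_prod_def lessThan_atLeast0)
  finally show "(kron A B * kron C D) $$ (i, j) = kron (A * C) (B * D) $$ (i, j)" .
qed (use assms in \<open>auto simp: kron_def\<close>)

lemma kron_assoc:
  assumes "A \<in> carrier_mat n n" "B \<in> carrier_mat m m" "C \<in> carrier_mat p p"
  shows "kron (kron A B) C = kron A (kron B C)"
proof (rule eq_matI)
  fix i j assume "i < dim_row (kron A (kron B C))" "j < dim_col (kron A (kron B C))"
  then have ij: "i < n * (m * p)" "j < n * (m * p)" using assms by (auto simp: kron_def)
  then have p: "p > 0" "m > 0" by (auto intro!: gr0I)
  have "i div p < n * m" "j div p < n * m" "i mod (m * p) < m * p" "j mod (m * p) < m * p"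
    using ij p by (simp_all add: less_mult_imp_div_less ac_simps)
  moreover have "k mod (m * p) div p = k div p mod m" "k mod (m * p) mod p = k mod p"
    "k div (m * p) = k div p div m" for k
    using p by (simp_all add: mult.commute[of m p] mod_mult2_eq div_mult2_eq)
  ultimately show "kron (kron A B) C $$ (i, j) = kron A (kron B C) $$ (i, j)"
    using assms ij p by (simp add: kron_def ac_simps)
qed (use assms in \<open>auto simp: kron_def\<close>)

lemma kron_one: "kron (1\<^sub>m n) (1\<^sub>m m) = 1\<^sub>m (n * m)"
proof (rule eq_matI)
  fix i j assume "i < dim_row (1\<^sub>m (n * m) :: complex mat)" "j < dim_col (1\<^sub>m (n * m) :: complex mat)"
  then have ij: "i < n * m" "j < n * m" by auto
  then have lt: "i div m < n" "j div m < n" "i mod m < m" "j mod m < m"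
    by (auto simp: less_mult_imp_div_less intro!: mod_less_divisor gr0I)
  have "i div m = j div m \<and> i mod m = j mod m \<longleftrightarrow> i = j"
    by (metis div_mult_mod_eq)
  then show "kron (1\<^sub>m n) (1\<^sub>m m) $$ (i, j) = 1\<^sub>m (n * m) $$ (i, j)"
    using ij lt by (auto simp: kron_def)
qed (auto simp: kron_def)

lemma kron_uminus_right:
  assumes "A \<in> carrier_mat n n" "B \<in> carrier_mat m m"
  shows "kron A (- B) = - kron A B"
proof (rule eq_matI)
  fix i j assume "i < dim_row (- kron A B)" "j < dim_col (- kron A B)"
  then have ij: "i < n * m" "j < n * m" using assms by (auto simp: kron_def)
  then have "i div m < n" "j div m < n" "i mod m < m" "j mod m < m"
    by (auto simp: less_mult_imp_div_less intro!: mod_less_divisor gr0I)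
  then show "kron A (- B) $$ (i, j) = (- kron A B) $$ (i, j)"
    using assms ij by (simp add: kron_def)
qed (use assms in \<open>auto simp: kron_def\<close>)

lemma kron_uminus_left:
  assumes "A \<in> carrier_mat n n" "B \<in> carrier_mat m m"
  shows "kron (- A) B = - kron A B"
proof (rule eq_matI)
  fix i j assume "i < dim_row (- kron A B)" "j < dim_col (- kron A B)"
  then have ij: "i < n * m" "j < n * m" using assms by (auto simp: kron_def)
  then have "i div m < n" "j div m < n" "i mod m < m" "j mod m < m"
    by (auto simp: less_mult_imp_div_less intro!: mod_less_divisor gr0I)
  then show "kron (- A) B $$ (i, j) = (- kron A B) $$ (i, j)"
    using assms ij by (simp add: kron_def)
qed (use assms in \<open>auto simp: kron_def\<close>)

lemma kron_pow_one: "kron_pow (1\<^sub>m 2) k = 1\<^sub>m (2 ^ k)"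
  by (induction k) (simp_all add: kron_one)

lemma pauli_carrier [simp]: "pauli a \<in> carrier_mat 2 2"
  by (cases a) (auto simp: mat_of_rows_list_def)

lemma mat2_mult:
  fixes a :: "'a :: comm_semiring_1"
  shows "mat_of_rows_list 2 [[a, b], [c, d]] * mat_of_rows_list 2 [[a', b'], [c', d']] =
    mat_of_rows_list 2 [[a * a' + b * c', a * b' + b * d'], [c * a' + d * c', c * b' + d * d']]"
  by (intro eq_matI) (auto simp: mat_of_rows_list_def scalar_prod_def less_Suc_eq numeral_2_eq_2)

lemma mat2_one: "1\<^sub>m 2 = mat_of_rows_list 2 [[1, 0], [0, 1]]"
  by (intro eq_matI) (auto simp: mat_of_rows_list_def less_Suc_eq numeral_2_eq_2)

lemma pauli_square: "pauli a * pauli a = 1\<^sub>m 2"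
  by (cases a) (simp_all add: mat2_mult mat2_one)

lemma mat2_uminus:
  fixes a :: "'a :: comm_ring_1"
  shows "- mat_of_rows_list 2 [[a, b], [c, d]] = mat_of_rows_list 2 [[- a, - b], [- c, - d]]"
  by (intro eq_matI) (auto simp: mat_of_rows_list_def less_Suc_eq numeral_2_eq_2)

lemma pauli_anticommute: "a \<noteq> b \<Longrightarrow> pauli b * pauli a = - (pauli a * pauli b)"
  by (cases a; cases b) (simp_all add: mat2_mult mat2_uminus)

lemma spin_eq: "spin N a i = kron (kron (1\<^sub>m (2 ^ (i - 1))) (pauli a)) (1\<^sub>m (2 ^ (N - i)))"
  by (simp add: spin_def kron_pow_one)

lemma power_split: "1 \<le> i \<Longrightarrow> i \<le> N \<Longrightarrow> (2::nat) ^ (i - 1) * 2 * 2 ^ (N - i) = 2 ^ N"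
  by (simp flip: power_Suc2 power_add)

lemma spin_carrier [simp]:
  assumes "1 \<le> i" "i \<le> N"
  shows "spin N a i \<in> carrier_mat (2 ^ N) (2 ^ N)"
  unfolding spin_eq power_split[OF assms, symmetric] by (intro kron_carrier) auto

lemma spin_mult:
  assumes "1 \<le> i" "i \<le> N"
  shows "spin N a i * spin N b i = kron (kron (1\<^sub>m (2 ^ (i - 1))) (pauli a * pauli b)) (1\<^sub>m (2 ^ (N - i)))"
  by (simp add: spin_eq kron_mult[of _ "2 ^ (i - 1) * 2" _ "2 ^ (N - i)"]
      kron_mult[of _ "2 ^ (i - 1)" _ 2])

lemma spin_square:
  assumes "1 \<le> i" "i \<le> N"
  shows "spin N a i * spin N a i = 1\<^sub>m (2 ^ N)"
  unfolding spin_mult[OF assms] pauli_square kron_one power_split[OF assms] ..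

lemma spin_anticommute:
  assumes "1 \<le> i" "i \<le> N" "a \<noteq> b"
  shows "spin N b i * spin N a i = - (spin N a i * spin N b i)"
proof -
  have p: "pauli a * pauli b \<in> carrier_mat 2 2"
    by (intro mult_carrier_mat[of _ _ 2]) auto
  show ?thesis
    unfolding spin_mult[OF assms(1,2)] pauli_anticommute[OF assms(3)]
      kron_uminus_right[OF one_carrier_mat p]
    by (rule kron_uminus_left[OF kron_carrier[OF one_carrier_mat p] one_carrier_mat])
qed

lemma spin_shift:
  assumes "i < j" "j \<le> N"
  shows "spin N b j = kron (1\<^sub>m (2 ^ i)) (spin (N - i) b (j - i))"
proof -
  let ?k = "j - i - 1"
  have "(2::nat) ^ (j - 1) = 2 ^ i * 2 ^ ?k"
    using assms by (simp flip: power_add)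
  then have "1\<^sub>m (2 ^ (j - 1)) = kron (1\<^sub>m (2 ^ i)) (1\<^sub>m (2 ^ ?k))"
    by (simp only: kron_one)
  then have "spin N b j =
      kron (kron (kron (1\<^sub>m (2 ^ i)) (1\<^sub>m (2 ^ ?k))) (pauli b)) (1\<^sub>m (2 ^ (N - j)))"
    by (simp only: spin_eq)
  also have "\<dots> = kron (1\<^sub>m (2 ^ i)) (kron (kron (1\<^sub>m (2 ^ ?k)) (pauli b)) (1\<^sub>m (2 ^ (N - j))))"
    by (simp add: kron_assoc[of _ "2 ^ i" _ "2 ^ ?k" _ 2]
        kron_assoc[of _ "2 ^ i" _ "2 ^ ?k * 2" _ "2 ^ (N - j)"])
  finally show ?thesis using assms by (simp add: spin_eq)
qed

lemma spin_commute:
  assumes "1 \<le> i" "i < j" "j \<le> N"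
  shows "spin N a i * spin N b j = spin N b j * spin N a i"
proof -
  let ?X = "kron (1\<^sub>m (2 ^ (i - 1))) (pauli a)" and ?Y = "spin (N - i) b (j - i)"
  have "(2::nat) ^ (i - 1) * 2 = 2 ^ i"
    using assms by (cases i) simp_all
  then have X: "?X \<in> carrier_mat (2 ^ i) (2 ^ i)"
    by (metis kron_carrier one_carrier_mat pauli_carrier)
  have Y: "?Y \<in> carrier_mat (2 ^ (N - i)) (2 ^ (N - i))"
    using assms by simp
  show ?thesis
    unfolding spin_shift[OF assms(2,3)] spin_eq[of N a i]
    using X Y by (simp add: kron_mult[of _ "2 ^ i" _ "2 ^ (N - i)"])
qed

section \<open>Bond operators: involutions that commute or anticommute\<close>

definition bond :: "nat \<Rightarrow> axis \<Rightarrow> nat \<Rightarrow> complex mat" where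
  "bond N a i = spin N a i * spin N a (Suc i)"

lemma bond_carrier [simp]:
  assumes "1 \<le> i" "i < N"
  shows "bond N a i \<in> carrier_mat (2 ^ N) (2 ^ N)"
  unfolding bond_def using assms by (intro mult_carrier_mat[of _ _ "2 ^ N"] spin_carrier) auto

lemma mat_mult_swap_middle:
  fixes A B C D :: "complex mat"
  assumes "A \<in> carrier_mat n n" "B \<in> carrier_mat n n" "C \<in> carrier_mat n n" "D \<in> carrier_mat n n"
    and "B * C = C * B"
  shows "(A * B) * (C * D) = (A * C) * (B * D)"
proof -
  have "(A * B) * (C * D) = A * ((B * C) * D)"
    using assms(1-4) by (simp add: assoc_mult_mat[of _ n n _ n _ n])
  also have "\<dots> = (A * C) * (B * D)"
    using assms(1-4) unfolding assms(5) by (simp add: assoc_mult_mat[of _ n n _ n _ n])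
  finally show ?thesis .
qed

lemma bond_square:
  assumes "1 \<le> i" "i < N"
  shows "bond N a i * bond N a i = 1\<^sub>m (2 ^ N)"
proof -
  let ?n = "2 ^ N :: nat"
  have "bond N a i * bond N a i = (spin N a i * spin N a i) * (spin N a (Suc i) * spin N a (Suc i))"
    unfolding bond_def using assms
    by (intro mat_mult_swap_middle[of _ ?n] spin_carrier spin_commute[symmetric]) auto
  then show ?thesis using assms by (simp add: spin_square)
qed

lemma mat_mult_commute:
  fixes A B C :: "complex mat"
  assumes "A \<in> carrier_mat n n" "B \<in> carrier_mat n n" "C \<in> carrier_mat n n"
    and "A * C = C * A" "B * C = C * B"
  shows "(A * B) * C = C * (A * B)"
proof -
  have "(A * B) * C = (A * C) * B"
    using assms(1-3,5) by (simp add: assoc_mult_mat[of _ n n _ n _ n])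
  also have "\<dots> = C * (A * B)"
    using assms(1-3) unfolding assms(4) by (simp add: assoc_mult_mat[of _ n n _ n _ n])
  finally show ?thesis .
qed

lemma bond_commute:
  assumes "1 \<le> i" "Suc i < j" "j < N"
  shows "bond N a i * bond N b j = bond N b j * bond N a i"
proof -
  let ?n = "2 ^ N :: nat"
  have "spin N a k * bond N b j = bond N b j * spin N a k" if "1 \<le> k" "k < j" for k
    unfolding bond_def using that assms
    by (intro mat_mult_commute[of _ ?n, symmetric] spin_carrier spin_commute[symmetric]) auto
  moreover have "bond N b j \<in> carrier_mat ?n ?n" using assms by simp
  ultimately show ?thesis
    unfolding bond_def[of N a] using assms
    by (intro mat_mult_commute[of _ ?n] spin_carrier) auto
qed

text \<open>The two bonds meet only at spin \<open>Suc i\<close>, where they carry distinct Pauli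
  matrices. Exchanging these two factors gives the single sign; all other exchanges are free. The
  condition on adjacent axes in the theorem enters here.\<close>

lemma bond_anticommute:
  assumes "1 \<le> i" "Suc i < N" "a \<noteq> b"
  shows "bond N b (Suc i) * bond N a i = - (bond N a i * bond N b (Suc i))"
proof -
  let ?n = "2 ^ N :: nat"
  let ?A = "spin N a i" and ?B = "spin N a (Suc i)" and ?C = "spin N b (Suc i)"
    and ?D = "spin N b (Suc (Suc i))"
  have c: "?A \<in> carrier_mat ?n ?n" "?B \<in> carrier_mat ?n ?n" "?C \<in> carrier_mat ?n ?n"
    "?D \<in> carrier_mat ?n ?n" using assms by auto
  have A: "?A * ?C = ?C * ?A" and D: "?D * (?A * ?B) = (?A * ?B) * ?D"
    using assms by (auto intro!: spin_commute mat_mult_commute[of _ ?n, symmetric] spin_carrier)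
  have "(?C * ?D) * (?A * ?B) = ?C * (?D * (?A * ?B))"
    using c by (intro assoc_mult_mat[of _ ?n ?n _ ?n _ ?n]) auto
  also have "\<dots> = (?C * ?A) * (?B * ?D)"
    unfolding D using c by (simp add: assoc_mult_mat[of _ ?n ?n _ ?n _ ?n])
  also have "\<dots> = ?A * ((?C * ?B) * ?D)"
    unfolding A[symmetric] using c by (simp add: assoc_mult_mat[of _ ?n ?n _ ?n _ ?n])
  also have "\<dots> = - (?A * ((?B * ?C) * ?D))"
    using c[THEN carrier_matD(1)] c[THEN carrier_matD(2)] assms(1,2)
    by (simp add: spin_anticommute[OF _ _ assms(3)])
  also have "\<dots> = - ((?A * ?B) * (?C * ?D))"
    using c by (simp add: assoc_mult_mat[of _ ?n ?n _ ?n _ ?n])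
  finally show ?thesis by (simp add: bond_def)
qed

section \<open>Rotations generated by involutions\<close>

definition cis_mat :: "complex mat \<Rightarrow> real \<Rightarrow> complex mat" where
  "cis_mat P \<theta> = complex_of_real (cos (\<theta> / 2)) \<cdot>\<^sub>m 1\<^sub>m (dim_row P) +
     (- \<i> * complex_of_real (sin (\<theta> / 2))) \<cdot>\<^sub>m P"

lemma cis_mat_carrier [simp]: "P \<in> carrier_mat n n \<Longrightarrow> cis_mat P \<theta> \<in> carrier_mat n n"
  by (auto simp: cis_mat_def)

lemma pow_smult_involution:
  fixes P :: "complex mat"
  assumes P: "P \<in> carrier_mat n n" "P * P = 1\<^sub>m n"
  shows "(z \<cdot>\<^sub>m P) ^\<^sub>m k = z ^ k \<cdot>\<^sub>m (if even k then 1\<^sub>m n else P)"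
  using assms by (induction k) (auto intro!: eq_matI simp: mult_smult_distrib[of _ n n _ n]
      mult_smult_assoc_mat[of _ n n _ n] ac_simps)

text \<open>The spectral projections of \<open>P\<close> are \<open>(1 + P) / 2\<close> and
  \<open>(1 - P) / 2\<close>, with exponentials of \<open>z\<close> and \<open>- z\<close>. Read
  entrywise, the matrix series is a combination of two scalar exponential series, whose even and odd
  terms reproduce the powers of \<open>z P\<close>.\<close>

lemma mat_exp_involution:
  assumes P: "P \<in> carrier_mat n n" "P * P = 1\<^sub>m n"
  shows "mat_exp ((- \<i> * complex_of_real \<theta> / 2) \<cdot>\<^sub>m P) = cis_mat P \<theta>"
proof (rule eq_matI)
  let ?z = "- \<i> * complex_of_real \<theta> / 2"
  fix i j assume "i < dim_row (cis_mat P \<theta>)" "j < dim_col (cis_mat P \<theta>)"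
  then have ij: "i < n" "j < n" using P by (auto simp: cis_mat_def)
  let ?I = "(1\<^sub>m n :: complex mat) $$ (i, j)" and ?P = "P $$ (i, j)"
  have "(\<lambda>k. ?z ^ k /\<^sub>R fact k * ((?I + ?P) / 2) + (- ?z) ^ k /\<^sub>R fact k * ((?I - ?P) / 2))
      sums (exp ?z * ((?I + ?P) / 2) + exp (- ?z) * ((?I - ?P) / 2))"
    by (intro sums_add sums_mult2 exp_converges)
  moreover have "?z ^ k /\<^sub>R fact k * ((?I + ?P) / 2) + (- ?z) ^ k /\<^sub>R fact k * ((?I - ?P) / 2)
      = ((?z \<cdot>\<^sub>m P) ^\<^sub>m k) $$ (i, j) / fact k" for k
  proof -
    have pow: "((?z \<cdot>\<^sub>m P) ^\<^sub>m k) $$ (i, j) = ?z ^ k * (if even k then ?I else ?P)"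
      unfolding pow_smult_involution[OF P] using ij P by simp
    show ?thesis
      unfolding pow by (cases "even k") (simp_all only: scaleR_conv_of_real power_minus_even
          power_minus_odd if_True if_False, simp_all add: field_simps del: index_one_mat)
  qed
  ultimately have "(\<lambda>k. ((?z \<cdot>\<^sub>m P) ^\<^sub>m k) $$ (i, j) / fact k)
      sums (exp ?z * ((?I + ?P) / 2) + exp (- ?z) * ((?I - ?P) / 2))"
    by simp
  moreover have "exp ?z * ((?I + ?P) / 2) + exp (- ?z) * ((?I - ?P) / 2) = cis_mat P \<theta> $$ (i, j)"
  proof -
    have e: "exp ?z = complex_of_real (cos (\<theta> / 2)) - \<i> * complex_of_real (sin (\<theta> / 2))"
      "exp (- ?z) = complex_of_real (cos (\<theta> / 2)) + \<i> * complex_of_real (sin (\<theta> / 2))"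
      using cis_conv_exp[of "- (\<theta> / 2)"] cis_conv_exp[of "\<theta> / 2"]
      by (simp_all add: cis.code mult.commute complex_eq_iff)
    show ?thesis
      unfolding e using ij P by (cases "i = j") (simp_all add: cis_mat_def field_simps)
  qed
  ultimately show "mat_exp (?z \<cdot>\<^sub>m P) $$ (i, j) = cis_mat P \<theta> $$ (i, j)"
    using ij P by (simp add: mat_exp_def sums_iff)
qed (use P in \<open>auto simp: mat_exp_def cis_mat_def\<close>)

lemma rot_eq_cis_mat:
  assumes "1 \<le> i" "i < N"
  shows "rot N a i \<theta> = cis_mat (bond N a i) \<theta>"
  unfolding rot_def Suc_eq_plus1[symmetric] bond_def[symmetric]
  using assms by (intro mat_exp_involution[of _ "2 ^ N"] bond_square bond_carrier)

lemma cis_mat_0: "P \<in> carrier_mat n n \<Longrightarrow> cis_mat P 0 = 1\<^sub>m n"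
  by (intro eq_matI) (auto simp: cis_mat_def)

lemma cis_mat_commute:
  assumes P: "P \<in> carrier_mat n n" and Q: "Q \<in> carrier_mat n n" and "P * Q = Q * P"
  shows "cis_mat P a * cis_mat Q b = cis_mat Q b * cis_mat P a"
  using assms
  by (intro eq_matI) (auto simp: cis_mat_def algebra_simps add_mult_distrib_mat[of _ n n _ _ n]
      mult_add_distrib_mat[of _ n n _ n] mult_smult_distrib[of _ n n _ n] mult_smult_assoc_mat[of _ n n _ n])

lemma cis_mat_add:
  assumes P: "P \<in> carrier_mat n n" and "P * P = 1\<^sub>m n"
  shows "cis_mat P a * cis_mat P b = cis_mat P (a + b)"
proof (rule eq_matI)
  fix i j assume "i < dim_row (cis_mat P (a + b))" "j < dim_col (cis_mat P (a + b))"
  then have "i < n" "j < n" using P by (auto simp: cis_mat_def)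
  then show "(cis_mat P a * cis_mat P b) $$ (i, j) = cis_mat P (a + b) $$ (i, j)"
    using assms
    by (cases "i = j") (simp_all add: cis_mat_def add_mult_distrib_mat[of _ n n _ _ n] cos_add sin_add
      mult_add_distrib_mat[of _ n n _ n] mult_smult_distrib[of _ n n _ n] add_divide_distrib
      mult_smult_assoc_mat[of _ n n _ n] algebra_simps)
qed (use P in \<open>auto simp: cis_mat_def\<close>)

text \<open>The gates generated by two anticommuting involutions are unit quaternions, and any unit
  quaternion has an Euler decomposition about either pair of axes.\<close>

lemma euler_angles:
  fixes x y z w :: real
  assumes "x\<^sup>2 + y\<^sup>2 + z\<^sup>2 + w\<^sup>2 = 1"
  obtains a b c where "x = cos (b / 2) * cos ((a + c) / 2)" "y = cos (b / 2) * sin ((a + c) / 2)"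
    "z = sin (b / 2) * cos ((a - c) / 2)" "w = sin (b / 2) * sin ((a - c) / 2)"
proof -
  \<comment> \<open>Polar coordinates for each pair; the two radii lie on the unit circle and supply
    the third angle \<open>t\<close>.\<close>
  obtain r s where r: "x = r * cos s" "y = r * sin s" using polar_Ex by blast
  obtain u v where u: "z = u * cos v" "w = u * sin v" using polar_Ex by blast
  have "r\<^sup>2 * ((cos s)\<^sup>2 + (sin s)\<^sup>2) + u\<^sup>2 * ((cos v)\<^sup>2 + (sin v)\<^sup>2) = 1"
    using assms by (simp add: r u power_mult_distrib algebra_simps del: sin_cos_squared_add sin_cos_squared_add2)
  then have "r\<^sup>2 + u\<^sup>2 = 1" by simp
  then obtain t where "r = cos t" "u = sin t" using sincos_total_2pi by metis
  then show thesis
    \<comment> \<open>The instantiation follows the order of occurrence \<open>b\<close>,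
      \<open>a\<close>, \<open>c\<close>; \<open>a = s + v\<close> and \<open>c = s - v\<close> have
      half sum \<open>s\<close> and half difference \<open>v\<close>.\<close>
    using r u that[of "2 * t" "s + v" "s - v"] by simp
qed

locale anticommuting_involutions =
  fixes n :: nat and P Q :: "complex mat"
  assumes P: "P \<in> carrier_mat n n" and Q: "Q \<in> carrier_mat n n"
    and PP: "P * P = 1\<^sub>m n" and QQ: "Q * Q = 1\<^sub>m n" and QP: "Q * P = - (P * Q)"
begin

text \<open>Coordinates with respect to \<open>1, P, Q, P * Q\<close>. The quaternion units are -iP,
  -iQ and -PQ, so products of rotations have real coordinates up to these factors.\<close>

definition comb :: "complex \<Rightarrow> complex \<Rightarrow> complex \<Rightarrow> complex \<Rightarrow> complex mat" where
  "comb x y z w = x \<cdot>\<^sub>m 1\<^sub>m n + (y \<cdot>\<^sub>m P + (z \<cdot>\<^sub>m Q + w \<cdot>\<^sub>m (P * Q)))"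

lemma PQ: "P * Q \<in> carrier_mat n n" using P Q by simp

lemma PQP: "P * (Q * P) = - Q"
proof -
  have "P * (Q * P) = - ((P * P) * Q)" using P Q by (simp add: QP)
  then show ?thesis using Q by (simp add: PP)
qed

text \<open>The minus signs come from \<open>Q * P = - (P * Q)\<close> and
  \<open>P * Q * P = - Q\<close>. Right multiplication by one rotation at a time suffices to expand
  a product of three.\<close>

lemma comb_mult_P: "comb x y z w * (c \<cdot>\<^sub>m 1\<^sub>m n + d \<cdot>\<^sub>m P) =
    comb (x * c + y * d) (y * c + x * d) (z * c - w * d) (w * c - z * d)"
proof -
  have "comb x y z w * (c \<cdot>\<^sub>m 1\<^sub>m n + d \<cdot>\<^sub>m P) =
    c \<cdot>\<^sub>m comb x y z w + d \<cdot>\<^sub>m (x \<cdot>\<^sub>m P + (y \<cdot>\<^sub>m 1\<^sub>m n + (z \<cdot>\<^sub>m - (P * Q) + w \<cdot>\<^sub>m - Q)))"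
    using P Q PQ PQP unfolding comb_def QP[symmetric] PQP[symmetric]
    by (simp add: PP add_mult_distrib_mat[of _ n n _ _ n] mult_add_distrib_mat[of _ n n _ n]
        mult_smult_distrib[of _ n n _ n] mult_smult_assoc_mat[of _ n n _ n])
  also have "\<dots> = comb (x * c + y * d) (y * c + x * d) (z * c - w * d) (w * c - z * d)"
    using P Q PQ unfolding comb_def by (intro eq_matI) (auto simp: algebra_simps simp del: index_mult_mat(1))
  finally show ?thesis .
qed

lemma comb_mult_Q: "comb x y z w * (c \<cdot>\<^sub>m 1\<^sub>m n + d \<cdot>\<^sub>m Q) =
    comb (x * c + z * d) (y * c + w * d) (z * c + x * d) (w * c + y * d)"
proof -
  have "comb x y z w * (c \<cdot>\<^sub>m 1\<^sub>m n + d \<cdot>\<^sub>m Q) =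
    c \<cdot>\<^sub>m comb x y z w + d \<cdot>\<^sub>m (x \<cdot>\<^sub>m Q + (y \<cdot>\<^sub>m (P * Q) + (z \<cdot>\<^sub>m 1\<^sub>m n + w \<cdot>\<^sub>m P)))"
    using P Q PQ unfolding comb_def
    by (simp add: add_mult_distrib_mat[of _ n n _ _ n] mult_add_distrib_mat[of _ n n _ n]
        mult_smult_distrib[of _ n n _ n] mult_smult_assoc_mat[of _ n n _ n] QQ)
  also have "\<dots> = comb (x * c + z * d) (y * c + w * d) (z * c + x * d) (w * c + y * d)"
    using P Q PQ unfolding comb_def by (intro eq_matI) (auto simp: algebra_simps simp del: index_mult_mat(1))
  finally show ?thesis .
qed

lemma comb_P: "c \<cdot>\<^sub>m 1\<^sub>m n + d \<cdot>\<^sub>m P = comb c d 0 0"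
  and comb_Q: "c \<cdot>\<^sub>m 1\<^sub>m n + d \<cdot>\<^sub>m Q = comb c 0 d 0"
  using P Q PQ unfolding comb_def by (intro eq_matI; auto simp del: index_mult_mat(1))+

lemma dim_PQ: "dim_row P = n" "dim_row Q = n" using P Q by auto

lemma cis_mat_PQP: "cis_mat P a * cis_mat Q b * cis_mat P c =
    comb (cos (b / 2) * cos ((a + c) / 2)) (- \<i> * (cos (b / 2) * sin ((a + c) / 2)))
      (- \<i> * (sin (b / 2) * cos ((a - c) / 2))) (- (sin (b / 2) * sin ((a - c) / 2)))"
  unfolding cis_mat_def dim_PQ comb_P[of "complex_of_real (cos (a / 2))"] comb_mult_Q comb_mult_P
    add_divide_distrib diff_divide_distrib cos_add sin_add cos_diff sin_diff
  by (rule arg_cong4[where f = comb]) (simp_all add: algebra_simps)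

lemma cis_mat_QPQ: "cis_mat Q a * cis_mat P b * cis_mat Q c =
    comb (cos (b / 2) * cos ((a + c) / 2)) (- \<i> * (sin (b / 2) * cos ((a - c) / 2)))
      (- \<i> * (cos (b / 2) * sin ((a + c) / 2))) (sin (b / 2) * sin ((a - c) / 2))"
  unfolding cis_mat_def dim_PQ comb_Q[of "complex_of_real (cos (a / 2))"] comb_mult_Q comb_mult_P
    add_divide_distrib diff_divide_distrib cos_add sin_add cos_diff sin_diff
  by (rule arg_cong4[where f = comb]) (simp_all add: algebra_simps)

text \<open>Interchanging the roles of \<open>P\<close> and \<open>Q\<close> swaps the two middle
  coordinates and, since \<open>Q * P = - (P * Q)\<close>, reverses the sign of the last. The new
  angles are therefore Euler angles of \<open>(?x, ?z, ?y, - ?w)\<close>.\<close>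

lemma turnover:
  "\<exists>a' b' c'. cis_mat P a * cis_mat Q b * cis_mat P c = cis_mat Q a' * cis_mat P b' * cis_mat Q c'"
proof -
  let ?x = "cos (b / 2) * cos ((a + c) / 2)" and ?y = "cos (b / 2) * sin ((a + c) / 2)"
    and ?z = "sin (b / 2) * cos ((a - c) / 2)" and ?w = "sin (b / 2) * sin ((a - c) / 2)"
  have "?x\<^sup>2 + ?y\<^sup>2 + (?z\<^sup>2 + ?w\<^sup>2) = (cos (b / 2))\<^sup>2 + (sin (b / 2))\<^sup>2"
    unfolding power_mult_distrib distrib_left[symmetric] by simp
  then have "?x\<^sup>2 + ?z\<^sup>2 + ?y\<^sup>2 + (- ?w)\<^sup>2 = 1" by simp
  then obtain a' b' c' where
    "?x = cos (b' / 2) * cos ((a' + c') / 2)" "?z = cos (b' / 2) * sin ((a' + c') / 2)"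
    "?y = sin (b' / 2) * cos ((a' - c') / 2)" "- ?w = sin (b' / 2) * sin ((a' - c') / 2)"
    by (rule euler_angles)
  then have "cis_mat P a * cis_mat Q b * cis_mat P c = cis_mat Q a' * cis_mat P b' * cis_mat Q c'"
    unfolding cis_mat_PQP cis_mat_QPQ by (metis of_real_minus of_real_mult)
  then show ?thesis by blast
qed

end

subsection \<open>Operators realised by circuits\<close>

lemma rot_carrier [simp]: "1 \<le> i \<Longrightarrow> i < N \<Longrightarrow> rot N a i \<theta> \<in> carrier_mat (2 ^ N) (2 ^ N)"
  by (simp add: rot_eq_cis_mat)

lemma rot_0: "1 \<le> i \<Longrightarrow> i < N \<Longrightarrow> rot N a i 0 = 1\<^sub>m (2 ^ N)"
  using cis_mat_0[OF bond_carrier] by (simp add: rot_eq_cis_mat)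

lemma rot_add: "1 \<le> i \<Longrightarrow> i < N \<Longrightarrow> rot N a i \<theta> * rot N a i \<phi> = rot N a i (\<theta> + \<phi>)"
  using cis_mat_add[OF bond_carrier bond_square] by (simp add: rot_eq_cis_mat)

lemma rot_commute:
  assumes "1 \<le> i" "Suc i < j" "j < N"
  shows "rot N a i \<theta> * rot N b j \<phi> = rot N b j \<phi> * rot N a i \<theta>"
proof -
  have "cis_mat (bond N a i) \<theta> * cis_mat (bond N b j) \<phi> = cis_mat (bond N b j) \<phi> * cis_mat (bond N a i) \<theta>"
    using assms by (intro cis_mat_commute[of _ "2 ^ N"] bond_carrier bond_commute) auto
  then show ?thesis using assms by (simp add: rot_eq_cis_mat)
qed

lemma anticommuting_involutions_bond:
  assumes "1 \<le> i" "Suc i < N" "a \<noteq> b"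
  shows "anticommuting_involutions (2 ^ N) (bond N a i) (bond N b (Suc i))"
  using assms bond_anticommute[OF assms] by unfold_locales (simp_all add: bond_square)

lemma anticommuting_involutions_sym:
  assumes "anticommuting_involutions n P Q"
  shows "anticommuting_involutions n Q P"
proof -
  interpret anticommuting_involutions n P Q by fact
  show ?thesis by unfold_locales (simp_all add: P Q PP QQ QP)
qed

lemma op_prod_carrier:
  "\<forall>A\<in>set As. A \<in> carrier_mat (2 ^ N) (2 ^ N) \<Longrightarrow> op_prod N As \<in> carrier_mat (2 ^ N) (2 ^ N)"
  by (induction As) (auto simp: op_prod_def)

lemma op_prod_append:
  assumes "\<forall>A\<in>set (As @ Bs). A \<in> carrier_mat (2 ^ N) (2 ^ N)"
  shows "op_prod N (As @ Bs) = op_prod N As * op_prod N Bs"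
  using assms
proof (induction As)
  case Nil
  then show ?case using op_prod_carrier[of Bs N] by (simp add: op_prod_def)
next
  case (Cons A As)
  have "op_prod N As \<in> carrier_mat (2 ^ N) (2 ^ N)" "op_prod N Bs \<in> carrier_mat (2 ^ N) (2 ^ N)"
    using Cons.prems by (auto intro!: op_prod_carrier)
  with Cons show ?case
    by (simp add: op_prod_def assoc_mult_mat[of _ "2 ^ N" "2 ^ N" _ "2 ^ N" _ "2 ^ N"])
qed

definition axis_circuit :: "nat \<Rightarrow> (nat \<Rightarrow> axis) \<Rightarrow> circuit \<Rightarrow> bool" where
  "axis_circuit N \<alpha> c \<longleftrightarrow> (\<forall>g\<in>set c. 1 \<le> gate_pos g \<and> gate_pos g < N \<and> gate_axis g = \<alpha> (gate_pos g))"

lemma axis_circuit_append [simp]: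
  "axis_circuit N \<alpha> (c @ d) \<longleftrightarrow> axis_circuit N \<alpha> c \<and> axis_circuit N \<alpha> d"
  by (auto simp: axis_circuit_def)

lemma axis_circuit_gate_carrier:
  "axis_circuit N \<alpha> c \<Longrightarrow> g \<in> set c \<Longrightarrow> gate_op N g \<in> carrier_mat (2 ^ N) (2 ^ N)"
  by (simp add: axis_circuit_def gate_op_def)

lemma circuit_op_carrier:
  "axis_circuit N \<alpha> c \<Longrightarrow> circuit_op N c \<in> carrier_mat (2 ^ N) (2 ^ N)"
  unfolding circuit_op_def by (intro op_prod_carrier) (auto simp: axis_circuit_gate_carrier)

lemma circuit_op_append:
  assumes "axis_circuit N \<alpha> c" "axis_circuit N \<alpha> d"
  shows "circuit_op N (c @ d) = circuit_op N d * circuit_op N c"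
  unfolding circuit_op_def rev_append map_append
  using assms by (intro op_prod_append) (auto simp: axis_circuit_gate_carrier)

lemma circuit_op_single:
  "1 \<le> gate_pos g \<Longrightarrow> gate_pos g < N \<Longrightarrow> circuit_op N [g] = gate_op N g"
  using right_mult_one_mat[OF rot_carrier] by (simp add: circuit_op_def op_prod_def gate_op_def)

text \<open>Axes are fixed by the positions, so the angles are the only freedom left by the
  word.\<close>

definition realized :: "nat \<Rightarrow> (nat \<Rightarrow> axis) \<Rightarrow> nat list \<Rightarrow> complex mat set" where
  "realized N \<alpha> w = circuit_op N ` {c. axis_circuit N \<alpha> c \<and> map gate_pos c = w}"

lemma realized_carrier: "A \<in> realized N \<alpha> w \<Longrightarrow> A \<in> carrier_mat (2 ^ N) (2 ^ N)"
  using circuit_op_carrier by (auto simp: realized_def)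

text \<open>Concatenation in time becomes the reversed product of sets. As the set for
  \<open>u @ v\<close> depends only on those for \<open>u\<close> and \<open>v\<close>, the
  congruence rule of \<open>hecke\<close> is respected.\<close>

lemma realized_append:
  "realized N \<alpha> (u @ v) = {B * A | A B. A \<in> realized N \<alpha> u \<and> B \<in> realized N \<alpha> v}" (is "?L = ?R")
proof (intro equalityI subsetI)
  fix U assume "U \<in> ?L"
  then obtain c where c: "axis_circuit N \<alpha> c" "map gate_pos c = u @ v" "U = circuit_op N c"
    by (auto simp: realized_def)
  then obtain d e where de: "c = d @ e" "map gate_pos d = u" "map gate_pos e = v"
    by (auto simp: map_eq_append_conv)
  then have "U = circuit_op N e * circuit_op N d"
    using c circuit_op_append[of N \<alpha> d e] by simp
  then show "U \<in> ?R" using c de by (auto simp: realized_def)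
next
  fix U assume "U \<in> ?R"
  then obtain d e where "axis_circuit N \<alpha> d" "map gate_pos d = u" "axis_circuit N \<alpha> e"
    "map gate_pos e = v" "U = circuit_op N e * circuit_op N d"
    by (auto simp: realized_def)
  then show "U \<in> ?L"
    using circuit_op_append[of N \<alpha> d e] by (auto simp: realized_def intro!: image_eqI[of _ _ "d @ e"])
qed

lemma realized_single:
  assumes "1 \<le> i" "i < N"
  shows "realized N \<alpha> [i] = range (rot N (\<alpha> i) i)"
proof (intro equalityI subsetI)
  fix U assume "U \<in> realized N \<alpha> [i]"
  then obtain g where "gate_pos g = i" "gate_axis g = \<alpha> i" "U = circuit_op N [g]"
    by (auto simp: realized_def axis_circuit_def)
  then show "U \<in> range (rot N (\<alpha> i) i)"
    using assms circuit_op_single[of g N] by (auto simp: gate_op_def)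
next
  fix U assume "U \<in> range (rot N (\<alpha> i) i)"
  then obtain \<theta> where "U = rot N (\<alpha> i) i \<theta>" by auto
  then have "U = circuit_op N [Gate i (\<alpha> i) \<theta>]"
    using assms circuit_op_single[of "Gate i (\<alpha> i) \<theta>" N] by (simp add: gate_op_def)
  then show "U \<in> realized N \<alpha> [i]"
    using assms by (auto simp: realized_def axis_circuit_def intro!: image_eqI[of _ _ "[Gate i (\<alpha> i) \<theta>]"])
qed

lemma realized_pair:
  assumes "1 \<le> i" "i < N" "1 \<le> j" "j < N"
  shows "realized N \<alpha> [i, j] = {rot N (\<alpha> j) j b * rot N (\<alpha> i) i a | a b. True}"
  using realized_append[of N \<alpha> "[i]" "[j]"] assms by (auto simp: realized_single)

lemma realized_triple:
  assumes "1 \<le> i" "i < N" "1 \<le> j" "j < N"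
  shows "realized N \<alpha> [i, j, i] =
    {rot N (\<alpha> i) i c * rot N (\<alpha> j) j b * rot N (\<alpha> i) i a | a b c. True}"
proof -
  have "rot N (\<alpha> i) i c * rot N (\<alpha> j) j b * rot N (\<alpha> i) i a =
    rot N (\<alpha> i) i c * (rot N (\<alpha> j) j b * rot N (\<alpha> i) i a)" for a b c
    using assms by (intro assoc_mult_mat[of _ "2 ^ N" "2 ^ N" _ "2 ^ N" _ "2 ^ N"]) auto
  then show ?thesis
    using realized_append[of N \<alpha> "[i, j]" "[i]"] assms
    by (simp add: realized_single realized_pair) blast
qed

lemma realized_hecke:
  assumes "v \<approx> w" "set v \<subseteq> {1..<N}" and \<alpha>: "\<And>i. 1 \<le> i \<Longrightarrow> Suc i < N \<Longrightarrow> \<alpha> i \<noteq> \<alpha> (Suc i)"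
  shows "realized N \<alpha> v = realized N \<alpha> w"
  using assms(1,2)
proof (induction rule: hecke.induct)
  case (hecke_sym v w)
  then show ?case using hecke_set by blast
next
  case (hecke_trans u v w)
  then show ?case using hecke_set by blast
next
  case (hecke_append u u' v v')
  then show ?case by (simp add: realized_append)
next
  case (hecke_idem i)
  then have i: "1 \<le> i" "i < N" by auto
  \<comment> \<open>The inclusion from right to left splits a gate into itself and a gate of angle
    0.\<close>
  have "{rot N (\<alpha> i) i (b + a) | a b. True} = range (rot N (\<alpha> i) i)"
    by (auto intro: exI[of _ 0] simp: image_iff) (metis add_0)
  then show ?case
    using i by (simp add: realized_pair realized_single rot_add)
next
  case (hecke_comm i j)
  then have ij: "1 \<le> i" "i < N" "1 \<le> j" "j < N" by auto
  have "rot N (\<alpha> i) i a * rot N (\<alpha> j) j b = rot N (\<alpha> j) j b * rot N (\<alpha> i) i a" for a b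
    using ij hecke_comm.hyps by (intro rot_commute)
  then show ?case
    unfolding realized_pair[OF ij] realized_pair[OF ij(3,4,1,2)] by auto
next
  case (hecke_braid i)
  then have i: "1 \<le> i" "i < N" "1 \<le> Suc i" "Suc i < N" by auto
  let ?P = "bond N (\<alpha> i) i" and ?Q = "bond N (\<alpha> (Suc i)) (Suc i)"
  interpret PQ: anticommuting_involutions "2 ^ N" ?P ?Q
    using i \<alpha> by (intro anticommuting_involutions_bond) auto
  \<comment> \<open>The locale is instantiated in both orders because the equality of sets needs the
    turnover in both directions.\<close>
  interpret QP: anticommuting_involutions "2 ^ N" ?Q ?P
    using PQ.anticommuting_involutions_axioms by (rule anticommuting_involutions_sym)
  have "realized N \<alpha> [i, Suc i, i] = {cis_mat ?P c * cis_mat ?Q b * cis_mat ?P a | a b c. True}"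
    using i realized_triple[of i N "Suc i" \<alpha>] by (simp add: rot_eq_cis_mat)
  also have "\<dots> = {cis_mat ?Q c * cis_mat ?P b * cis_mat ?Q a | a b c. True}"
    using PQ.turnover QP.turnover by blast
  also have "\<dots> = realized N \<alpha> [Suc i, i, Suc i]"
    using i realized_triple[of "Suc i" N i \<alpha>] by (simp add: rot_eq_cis_mat)
  finally show ?case .
qed auto

section \<open>Padding and absorption of whole circuits\<close>

lemma one_in_realized:
  assumes "set w \<subseteq> {1..<N}"
  shows "1\<^sub>m (2 ^ N) \<in> realized N \<alpha> w"
  using assms
proof (induction w)
  case Nil
  have "circuit_op N [] = 1\<^sub>m (2 ^ N)" by (simp add: circuit_op_def op_prod_def)
  then show ?case by (auto simp: realized_def axis_circuit_def intro!: image_eqI[of _ _ "[]"])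
next
  case (Cons i w)
  then have i: "1 \<le> i" "i < N" by auto
  have "1\<^sub>m (2 ^ N) \<in> realized N \<alpha> [i]"
    using i rot_0[of i N "\<alpha> i"] by (metis realized_single rangeI)
  moreover have "1\<^sub>m (2 ^ N) \<in> realized N \<alpha> w" using Cons by simp
  ultimately have "1\<^sub>m (2 ^ N) * 1\<^sub>m (2 ^ N) \<in> realized N \<alpha> ([i] @ w)"
    unfolding realized_append by blast
  then show ?case by simp
qed

lemma realized_subset_absorbing:
  assumes "t @ w \<approx> t" "set t \<subseteq> {1..<N}" "set w \<subseteq> {1..<N}"
    and "\<And>i. 1 \<le> i \<Longrightarrow> Suc i < N \<Longrightarrow> \<alpha> i \<noteq> \<alpha> (Suc i)"
  shows "realized N \<alpha> w \<subseteq> realized N \<alpha> t"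
proof
  fix U assume U: "U \<in> realized N \<alpha> w"
  \<comment> \<open>The gates of \<open>t\<close> run first, all with angle 0, and contribute the
    factor 1 on the right.\<close>
  then have "U * 1\<^sub>m (2 ^ N) \<in> realized N \<alpha> (t @ w)"
    unfolding realized_append using one_in_realized[OF assms(2)] by blast
  also have "realized N \<alpha> (t @ w) = realized N \<alpha> t"
    using assms by (intro realized_hecke) auto
  finally show "U \<in> realized N \<alpha> t" using realized_carrier[OF U] by simp
qed

lemma set_triangle_word: "set (triangle_word N (N - 1)) \<subseteq> {1..<N}"
  by (auto simp: triangle_word_def)

lemma set_cotriangle_word: "set (cotriangle_word N) \<subseteq> {1..<N}"
  by (induction N) (auto simp del: upt_Suc)

lemma triangle_absorbs:
  assumes "set w \<subseteq> {1..<N}"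
  shows "triangle_word N (N - 1) @ w \<approx> triangle_word N (N - 1)"
proof (rule absorb_right_word)
  fix i assume "i \<in> set w"
  then have "1 \<le> i" "i < N" using assms by auto
  then show "triangle_word N (N - 1) @ [i] \<approx> triangle_word N (N - 1)"
    by (intro triangle_word_absorb) linarith+
qed

lemma triangle_hecke_brick: "triangle_word N (N - 1) \<approx> brick 1 N"
proof -
  let ?t = "triangle_word N (N - 1)"
  have "?t \<approx> ?t @ cotriangle_word N"
    by (intro hecke_sym[OF triangle_absorbs] set_cotriangle_word)
  also have "\<dots> \<approx> cotriangle_word N"
  proof (rule absorb_left_word)
    fix i assume "i \<in> set ?t"
    then have "1 \<le> i" "i < N" using set_triangle_word[of N] by auto
    then show "[i] @ cotriangle_word N \<approx> cotriangle_word N"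
      by (rule cotriangle_word_absorb)
  qed
  also have "\<dots> \<approx> brick 1 N"
    by (intro hecke_sym[OF brick_eq_cotriangle]) simp
  finally show ?thesis .
qed

text \<open>Drops the word. The triangle absorbs every word, so closure under products is all that
  has to be known about the Trotter evolution, and the order of its gates need not be written
  out.\<close>

definition circuit_ops :: "nat \<Rightarrow> (nat \<Rightarrow> axis) \<Rightarrow> complex mat set" where
  "circuit_ops N \<alpha> = circuit_op N ` {c. axis_circuit N \<alpha> c}"

lemma circuit_ops_mult:
  assumes "A \<in> circuit_ops N \<alpha>" "B \<in> circuit_ops N \<alpha>"
  shows "A * B \<in> circuit_ops N \<alpha>"
proof -
  obtain c d where "axis_circuit N \<alpha> c" "A = circuit_op N c" "axis_circuit N \<alpha> d" "B = circuit_op N d"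
    using assms by (auto simp: circuit_ops_def)
  then have "axis_circuit N \<alpha> (d @ c)" "A * B = circuit_op N (d @ c)"
    by (simp_all add: circuit_op_append)
  then show ?thesis by (auto simp: circuit_ops_def)
qed

lemma circuit_ops_op_prod:
  "\<forall>x\<in>set xs. f x \<in> circuit_ops N \<alpha> \<Longrightarrow> op_prod N (map f xs) \<in> circuit_ops N \<alpha>"
proof (induction xs)
  case Nil
  have "circuit_op N [] = 1\<^sub>m (2 ^ N)" by (simp add: circuit_op_def op_prod_def)
  then show ?case
    by (auto simp: circuit_ops_def op_prod_def axis_circuit_def intro!: image_eqI[of _ _ "[]"])
next
  case (Cons x xs)
  then have "f x * op_prod N (map f xs) \<in> circuit_ops N \<alpha>"
    by (intro circuit_ops_mult) auto
  then show ?case by (simp add: op_prod_def)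
qed

lemma rot_in_circuit_ops:
  assumes "1 \<le> i" "i < N"
  shows "rot N (\<alpha> i) i \<theta> \<in> circuit_ops N \<alpha>"
proof -
  have "rot N (\<alpha> i) i \<theta> \<in> realized N \<alpha> [i]" using assms by (simp add: realized_single)
  then show ?thesis by (auto simp: realized_def circuit_ops_def)
qed

lemma trotter_in_circuit_ops: "trotter_evolution N \<alpha> J t\<^sub>0 \<Delta>t n \<in> circuit_ops N \<alpha>"
  unfolding trotter_evolution_def trotter_step_def
  by (intro circuit_ops_op_prod circuit_ops_mult ballI rot_in_circuit_ops) auto

text \<open>The word of the given circuit may have any length, which makes the resulting circuit's
  shape independent of the number of Trotter steps.\<close>

lemma circuit_ops_subset_triangle:
  assumes "\<And>i. 1 \<le> i \<Longrightarrow> Suc i < N \<Longrightarrow> \<alpha> i \<noteq> \<alpha> (Suc i)"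
  shows "circuit_ops N \<alpha> \<subseteq> realized N \<alpha> (triangle_word N (N - 1))"
proof
  fix U assume "U \<in> circuit_ops N \<alpha>"
  then obtain c where c: "axis_circuit N \<alpha> c" "U \<in> realized N \<alpha> (map gate_pos c)"
    by (auto simp: circuit_ops_def realized_def)
  then have "set (map gate_pos c) \<subseteq> {1..<N}" by (auto simp: axis_circuit_def)
  then have "realized N \<alpha> (map gate_pos c) \<subseteq> realized N \<alpha> (triangle_word N (N - 1))"
    using assms by (intro realized_subset_absorbing triangle_absorbs set_triangle_word) auto
  with c show "U \<in> realized N \<alpha> (triangle_word N (N - 1))" by blast
qed

section \<open>Layers of the square circuit and its depth\<close>

lemma map_eq_concatD:
  "map f xs = concat yss \<Longrightarrow> \<exists>xss. xs = concat xss \<and> map (map f) xss = yss"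
proof (induction yss arbitrary: xs)
  case (Cons ys yss)
  then obtain as bs where "xs = as @ bs" "map f as = ys" "map f bs = concat yss"
    by (auto simp: map_eq_append_conv)
  moreover from Cons.IH[OF this(3)] obtain xss where "bs = concat xss" "map (map f) xss = yss"
    by blast
  ultimately show ?case by (intro exI[of _ "as # xss"]) simp
qed simp

lemma brick_circuit_layers:
  assumes "map gate_pos c = brick 1 N"
  obtains ls where "c = concat ls" "length ls = N"
    "\<And>k. k < N \<Longrightarrow> map gate_pos (ls ! k) = parity_row (Suc k) 1 N"
proof -
  obtain ls where ls: "c = concat ls" "map (map gate_pos) ls = map (\<lambda>m. parity_row m 1 N) [1..<1 + N]"
    using map_eq_concatD[of gate_pos c] assms unfolding brick_def by blast
  have len: "length ls = N" using arg_cong[OF ls(2), of length] by (simp del: upt_Suc)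
  have "map gate_pos (ls ! k) = parity_row (Suc k) 1 N" if "k < N" for k
    using arg_cong[OF ls(2), of "\<lambda>x. x ! k"] that len by (simp del: upt_Suc)
  with ls(1) len show thesis by (rule that)
qed

lemma brick_square_circuit:
  assumes "map gate_pos c = brick 1 N"
  shows "square_circuit N c"
proof -
  obtain ls where ls: "c = concat ls" "length ls = N"
    "\<And>k. k < N \<Longrightarrow> map gate_pos (ls ! k) = parity_row (Suc k) 1 N"
    using assms by (rule brick_circuit_layers) blast
  have "if even k then odd_layer N (ls ! k) else even_layer N (ls ! k)" if "k < N" for k
  proof -
    have "gate_pos ` set (ls ! k) = set (parity_row (Suc k) 1 N)"
      unfolding ls(3)[OF that, symmetric] by simp
    \<comment> \<open>List indices start at 0 but the layers of \<open>brick 1 N\<close> at 1, so an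
      even \<open>k\<close> belongs to the odd positions.\<close>
    also have "\<dots> = {i \<in> {1..N - 1}. odd i \<longleftrightarrow> even k}"
      using that by (auto simp: set_parity_row)
    finally have "gate_pos ` set (ls ! k) = {i \<in> {1..N - 1}. odd i \<longleftrightarrow> even k}" .
    moreover have "distinct (map gate_pos (ls ! k))"
      unfolding ls(3)[OF that] by (simp add: parity_row_def)
    ultimately show ?thesis
      by (simp add: odd_layer_def even_layer_def)
  qed
  then show ?thesis using ls(1,2) by (auto simp: square_circuit_def)
qed

definition disjoint_gates :: "circuit \<Rightarrow> bool" where
  "disjoint_gates l \<longleftrightarrow> (\<forall>i j. i < j \<longrightarrow> j < length l \<longrightarrow> gate_spins (l ! i) \<inter> gate_spins (l ! j) = {})"

text \<open>Each gate is executed at the time given by the index of its layer. Conflicts inside a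
  layer are excluded by disjointness, and later layers receive later times.\<close>

lemma layered_schedule:
  assumes "\<forall>l\<in>set ls. disjoint_gates l"
  shows "\<exists>s :: nat \<Rightarrow> nat. (\<forall>k < length (concat ls). s k < length ls) \<and>
    (\<forall>k l. k < l \<and> l < length (concat ls) \<and>
      gate_spins (concat ls ! k) \<inter> gate_spins (concat ls ! l) \<noteq> {} \<longrightarrow> s k < s l)"
  using assms
proof (induction ls rule: rev_induct)
  case (snoc x ls)
  then obtain s :: "nat \<Rightarrow> nat" where s: "\<forall>k < length (concat ls). s k < length ls"
    "\<forall>k l. k < l \<and> l < length (concat ls) \<and>
      gate_spins (concat ls ! k) \<inter> gate_spins (concat ls ! l) \<noteq> {} \<longrightarrow> s k < s l"
    by (metis (no_types, lifting) in_set_conv_decomp Un_iff set_append)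
  define n where "n = length (concat ls)"
  let ?s = "\<lambda>k. if k < n then s k else length ls"
  have order: "?s k < ?s l" if kl: "k < l" "l < length (concat (ls @ [x]))"
    "gate_spins (concat (ls @ [x]) ! k) \<inter> gate_spins (concat (ls @ [x]) ! l) \<noteq> {}" for k l
  proof -
    \<comment> \<open>Otherwise both gates lie in the last layer \<open>x\<close>, where no two
      gates share a spin.\<close>
    have "k < n"
    proof (rule ccontr)
      assume "\<not> k < n"
      then have "k - n < l - n" "l - n < length x" "\<not> l < n"
        using kl by (auto simp: n_def)
      moreover have "disjoint_gates x" using snoc.prems by simp
      ultimately show False
        using kl(3) \<open>\<not> k < n\<close> by (auto simp: disjoint_gates_def nth_append simp flip: n_def)
    qed
    then show ?thesis
      using s kl by (cases "l < n") (auto simp: nth_append simp flip: n_def)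
  qed
  have bound: "?s k < length (ls @ [x])" for k
    using s(1) by (simp add: n_def less_Suc_eq)
  show ?case
    by (rule exI[of _ ?s], intro conjI allI impI, rule bound, elim conjE, rule order)
qed simp

lemma circuit_depth_concat:
  assumes "\<forall>l\<in>set ls. disjoint_gates l"
  shows "circuit_depth (concat ls) \<le> length ls"
  unfolding circuit_depth_def by (rule Least_le) (rule layered_schedule[OF assms])

text \<open>Distinct positions of equal parity differ by at least two, so the spin pairs of gates in
  one layer are disjoint and each of the \<open>N\<close> layers takes a single time step.\<close>

lemma brick_circuit_depth:
  assumes "map gate_pos c = brick 1 N"
  shows "circuit_depth c \<le> N"
proof -
  obtain ls where ls: "c = concat ls" "length ls = N"
    "\<And>k. k < N \<Longrightarrow> map gate_pos (ls ! k) = parity_row (Suc k) 1 N"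
    using assms by (rule brick_circuit_layers) blast
  have "disjoint_gates (ls ! k)" if "k < N" for k
    unfolding disjoint_gates_def
  proof (intro allI impI)
    fix i j assume ij: "i < j" "j < length (ls ! k)"
    let ?p = "\<lambda>i. gate_pos (ls ! k ! i)"
    have "distinct (map gate_pos (ls ! k))"
      unfolding ls(3)[OF that] by (simp add: parity_row_def)
    then have "?p i \<noteq> ?p j" using ij by (auto simp: distinct_conv_nth)
    moreover have "even (?p m + Suc k)" if "m < length (ls ! k)" for m
    proof -
      have "?p m \<in> set (parity_row (Suc k) 1 N)"
        unfolding ls(3)[OF \<open>k < N\<close>, symmetric] using that by simp
      then show ?thesis by (simp add: set_parity_row)
    qed
    then have "even (?p i + Suc k)" "even (?p j + Suc k)" using ij by auto
    ultimately have "?p i \<noteq> ?p j" "Suc (?p i) \<noteq> ?p j" "?p i \<noteq> Suc (?p j)"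
      by presburger+
    then show "gate_spins (ls ! k ! i) \<inter> gate_spins (ls ! k ! j) = {}"
      by (auto simp: gate_spins_def)
  qed
  then show ?thesis
    using circuit_depth_concat[of ls] ls(1,2) by (metis in_set_conv_nth)
qed

lemma realizedE:
  assumes "U \<in> realized N \<alpha> w"
  obtains c where "axis_circuit N \<alpha> c" "map gate_pos c = w" "U = circuit_op N c"
  using assms by (auto simp: realized_def)

theorem mainTheorem3:
  shows "\<exists>D :: nat \<Rightarrow> nat. (\<lambda>N. real (D N)) \<in> O(\<lambda>N. real N) \<and>
    (\<forall>(N :: nat) (\<alpha> :: nat \<Rightarrow> axis) (J :: nat \<Rightarrow> axis \<Rightarrow> real \<Rightarrow> real) (H :: real \<Rightarrow> complex mat)
        (t\<^sub>0 :: real) (\<Delta>t :: real) (n\<^sub>t :: nat) (U :: complex mat).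
      N \<ge> 2 \<longrightarrow>
      (\<forall>i. 1 \<le> i \<and> i \<le> N - 2 \<longrightarrow> \<alpha> i \<noteq> \<alpha> (i + 1)) \<longrightarrow>
      (\<forall>t. H t = kitaev_hamiltonian N \<alpha> J t) \<longrightarrow>
      \<Delta>t > 0 \<longrightarrow>
      real n\<^sub>t > real N / 2 \<longrightarrow>
      U = trotter_evolution N \<alpha> J t\<^sub>0 \<Delta>t n\<^sub>t \<longrightarrow>
        (\<exists>c. square_circuit N c \<and> (\<forall>g \<in> set c. gate_axis g = \<alpha> (gate_pos g)) \<and> U = circuit_op N c) \<and>
        (\<exists>c. triangle_circuit N c \<and> (\<forall>g \<in> set c. gate_axis g = \<alpha> (gate_pos g)) \<and> U = circuit_op N c) \<and>
        (\<exists>c. is_circuit N c \<and> (\<forall>g \<in> set c. gate_axis g = \<alpha> (gate_pos g)) \<and> U = circuit_op N c \<and>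
          circuit_depth c \<le> D N))"
proof (intro exI[of _ "\<lambda>N. N"] conjI allI impI)
  \<comment> \<open>The identity serves as \<open>D\<close>, since the square circuit supplies the
    depth bound \<open>N\<close>.\<close>
  show "(\<lambda>N. real N) \<in> O(\<lambda>N. real N)" by simp
next
  fix N :: nat and \<alpha> :: "nat \<Rightarrow> axis" and J :: "nat \<Rightarrow> axis \<Rightarrow> real \<Rightarrow> real" and t\<^sub>0 \<Delta>t :: real
    and n\<^sub>t :: nat and U :: "complex mat"
  assume N: "2 \<le> N" and adj: "\<forall>i. 1 \<le> i \<and> i \<le> N - 2 \<longrightarrow> \<alpha> i \<noteq> \<alpha> (i + 1)"
    and U: "U = trotter_evolution N \<alpha> J t\<^sub>0 \<Delta>t n\<^sub>t"
  have \<alpha>: "\<alpha> i \<noteq> \<alpha> (Suc i)" if "1 \<le> i" "Suc i < N" for i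
    using adj that by simp
  have triangle: "U \<in> realized N \<alpha> (triangle_word N (N - 1))"
    using trotter_in_circuit_ops circuit_ops_subset_triangle[of N \<alpha>] \<alpha> U by blast
  then obtain c where c: "axis_circuit N \<alpha> c" "map gate_pos c = triangle_word N (N - 1)"
    "U = circuit_op N c"
    by (rule realizedE)
  \<comment> \<open>\<open>2 \<le> N\<close> gives \<open>Suc (N - 1) = N\<close>, so the
    \<open>N - 1\<close> cascades of the word are exactly those of the triangle circuit.\<close>
  have "triangle_circuit N c"
    using c(2) N by (simp add: triangle_circuit_def triangle_word_def)
  with c show "\<exists>c. triangle_circuit N c \<and> (\<forall>g\<in>set c. gate_axis g = \<alpha> (gate_pos g)) \<and> U = circuit_op N c"
    by (auto simp: axis_circuit_def)
  have "U \<in> realized N \<alpha> (brick 1 N)"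
    using triangle realized_hecke[OF triangle_hecke_brick[of N] set_triangle_word, of \<alpha>] \<alpha> by blast
  then obtain d where d: "axis_circuit N \<alpha> d" "map gate_pos d = brick 1 N" "U = circuit_op N d"
    by (rule realizedE)
  then show "\<exists>c. square_circuit N c \<and> (\<forall>g\<in>set c. gate_axis g = \<alpha> (gate_pos g)) \<and> U = circuit_op N c"
    using brick_square_circuit by (auto simp: axis_circuit_def)
  have "is_circuit N d"
    using d(1) by (auto simp: is_circuit_def axis_circuit_def)
  with d show "\<exists>c. is_circuit N c \<and> (\<forall>g\<in>set c. gate_axis g = \<alpha> (gate_pos g)) \<and>
      U = circuit_op N c \<and> circuit_depth c \<le> N"
    using brick_circuit_depth by (auto simp: axis_circuit_def)
qed

end
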